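(* Let $(G,H)$ be a rooted graph. For all $p=p(n)\in[0,1]$ and $\varepsilon=\varepsilon(n)\in(0,1]$ with $1-p=\Omega(1)$ and $\Phi\to\infty$, $$\lim_{n \to \infty} \Pr\Big(\max_{\mathbf{x} \in [n]_{v_G}}|X_{\mathbf{x}} - \mu| < \varepsilon\mu\Big) = \begin{cases} 0 &\text{if } \varepsilon^2 \Phi \to 0, \\ 1 &\text{if } \varepsilon^2 \Phi = n^{\Omega(1)}, \end{cases}$$ where $\mu=\mu_{G,H}$, $X_{\mathbf{x}}=X_{G,H}(\mathbf{x})$ and $\Phi=\Phi_{G,H}$.
   Context: $\mathbb{G}_{n,p}$ is the binomial random graph on $[n]=\{1,\dots,n\}$. For a graph $F$, $v_F,e_F$ are its numbers of vertices and edges. A rooted graph $(G,H)$ consists of a graph $H$ and an induced subgraph $G\subseteq H$ with labeled root vertices $V(G)=\{1,\dots,v_G\}$, with $e_H>e_G$. $[n]_{v_G}$ is the set of tuples $\mathbf{x}=(x_1,\dots,x_{v_G})$ of distinct vertices of $[n]$. A $(G,H)$-extension of $\mathbf{x}$ is a copy of $(V(H),E(H)\setminus E(G))$ in which each $j\in V(G)$ is mapped onto $x_j$ (counted as subgraphs). $X_{G,H}(\mathbf{x})$ is the number of $(G,H)$-extensions of $\mathbf{x}$ in $\mathbb{G}_{n,p}$ and $\mu_{G,H}=\mathbb{E}X_{G,H}(\mathbf{x})$. $\Phi_{G,H}=\min\{\mu_{G,J}: G\subseteq J\subseteq H,\ e_J>e_G\}$. $1-p=\Omega(1)$ means $1-p$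 is bounded below by a positive constant; $\varepsilon^2\Phi=n^{\Omega(1)}$ means $\varepsilon^2\Phi\ge n^{c}$ for some constant $c>0$ and all large $n$. *)

theory Defs
  imports "HOL-Probability.Probability" "HOL-Library.FuncSet"
begin

definition all_edges :: "nat set \<Rightarrow> nat set set" where
  "all_edges V = {e. e \<subseteq> V \<and> card e = 2}"

definition Gnp :: "nat \<Rightarrow> real \<Rightarrow> nat set set pmf" where
  "Gnp n p = map_pmf (\<lambda>f. {e \<in> all_edges {1..n}. f e})
              (Pi_pmf (all_edges {1..n}) False (\<lambda>_. bernoulli_pmf p))"

text \<open>A rooted graph (G,H) is given by vG, the vertex set VH and edge set EH of H;
  the roots are V(G) = {1..vG} and G is the subgraph of H induced on them.\<close>
definition root_edges :: "nat \<Rightarrow> nat set set \<Rightarrow> nat set set" where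
  "root_edges vG EH = {e \<in> EH. e \<subseteq> {1..vG}}"

definition rooted_graph :: "nat \<Rightarrow> nat set \<Rightarrow> nat set set \<Rightarrow> bool" where
  "rooted_graph vG VH EH \<longleftrightarrow> finite VH \<and> {1..vG} \<subseteq> VH \<and> EH \<subseteq> all_edges VH
      \<and> card EH > card (root_edges vG EH)"

definition tuples :: "nat \<Rightarrow> nat \<Rightarrow> (nat \<Rightarrow> nat) set" where
  "tuples n vG = {x \<in> {1..vG} \<rightarrow>\<^sub>E {1..n}. inj_on x {1..vG}}"

text \<open>(G,H)-extensions of x in K_n, counted as subgraphs (vertex set, edge set).\<close>
definition extensions :: "nat \<Rightarrow> nat set \<Rightarrow> nat set set \<Rightarrow> nat \<Rightarrow> (nat \<Rightarrow> nat)
     \<Rightarrow> (nat set \<times> nat set set) set" where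
  "extensions vG VH EH n x =
     {(\<phi> ` VH, (\<lambda>e. \<phi> ` e) ` (EH - root_edges vG EH)) | \<phi>.
        inj_on \<phi> VH \<and> \<phi> ` VH \<subseteq> {1..n} \<and> (\<forall>j\<in>{1..vG}. \<phi> j = x j)}"

definition ext_count :: "nat \<Rightarrow> nat set \<Rightarrow> nat set set \<Rightarrow> nat \<Rightarrow> (nat \<Rightarrow> nat)
     \<Rightarrow> nat set set \<Rightarrow> nat" where
  "ext_count vG VH EH n x E = card {c \<in> extensions vG VH EH n x. snd c \<subseteq> E}"

text \<open>mu_{G,H} = E X_{G,H}(x); independent of x, computed at the tuple (1,...,vG).\<close>
definition mu :: "nat \<Rightarrow> nat set \<Rightarrow> nat set set \<Rightarrow> nat \<Rightarrow> real \<Rightarrow> real" where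
  "mu vG VH EH n p =
     measure_pmf.expectation (Gnp n p) (\<lambda>E. real (ext_count vG VH EH n (\<lambda>j. j) E))"

definition Phi :: "nat \<Rightarrow> nat set \<Rightarrow> nat set set \<Rightarrow> nat \<Rightarrow> real \<Rightarrow> real" where
  "Phi vG VH EH n p = Min {mu vG VJ EJ n p | VJ EJ.
      {1..vG} \<subseteq> VJ \<and> VJ \<subseteq> VH \<and> EJ \<subseteq> EH \<and> EJ \<subseteq> all_edges VJ
      \<and> root_edges vG EH \<subseteq> EJ \<and> card EJ > card (root_edges vG EH)}"

definition conc_prob :: "nat \<Rightarrow> nat set \<Rightarrow> nat set set \<Rightarrow> nat \<Rightarrow> real \<Rightarrow> real \<Rightarrow> real" where
  "conc_prob vG VH EH n p eps =
     measure_pmf.prob (Gnp n p)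
       {E. Max ((\<lambda>x. \<bar>real (ext_count vG VH EH n x E) - mu vG VH EH n p\<bar>) ` tuples n vG)
           < eps * mu vG VH EH n p}"

end

theory Submission
  imports Defs
begin

text \<open>
  Up to a constant factor, \<open>X\<^sub>x - \<mu>\<close> is the sum \<open>W\<close>, over all embeddings of \<open>H\<close> extending \<open>x\<close>, of the
  centred indicators \<open>Y a\<close>. Given finitely many earlier embeddings, those sharing a free edge with them carry
  at most a proportion \<open>\<theta> = O(1/\<Phi>)\<close> of the total weight \<open>M\<close>, because the shared edges span some
  \<open>J\<close> with \<open>\<mu>\<^sub>J \<ge> \<Phi>\<close>. So each overlap in a sequence of \<open>m\<close> embeddings costs a factor \<open>\<theta>\<close>.

  If \<open>\<epsilon>\<^sup>2\<Phi> \<ge> n\<^sup>c\<close>: in a sequence of \<open>2k\<close> embeddings with nonzero contribution to \<open>E W\<^sup>2\<^sup>k\<close> each one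
  overlaps another, so read forwards or backwards at least \<open>k\<close> of them overlap an earlier one. Hence
  \<open>E W\<^sup>2\<^sup>k = O(M\<^sup>2\<^sup>k \<theta>\<^sup>k)\<close>, and Markov's inequality with a large constant \<open>k\<close> beats the union bound over \<open>x\<close>.

  If \<open>\<epsilon>\<^sup>2\<Phi> \<rightarrow> 0\<close>: a single \<open>x\<close> suffices. The variance is at least a constant times \<open>M\<^sup>2\<theta>\<close> (pairs
  agreeing on a minimizer of \<open>\<Phi>\<close>). Stein's identity \<open>E (W g(W)) \<approx> Var W \<cdot> E (g' (W))\<close> with the bounded
  function \<open>g(w) = arctan (w/h)\<close>, whose derivative is at least \<open>1/(2h)\<close> on \<open>[-h,h]\<close>, shows that
  \<open>\<bar>W\<bar> \<le> h\<close> has probability \<open>O(h / sqrt (Var W)) + o(1)\<close> for \<open>h\<close> of order \<open>M sqrt \<theta>\<close>, without a full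
  central limit theorem.
\<close>

subsection \<open>Sums of centred copy indicators\<close>

lemma expectation_pair_pmf_mult:
  fixes F :: "'a \<Rightarrow> real" and G :: "'b \<Rightarrow> real"
  assumes "finite (set_pmf P)" "finite (set_pmf Q)"
  shows "measure_pmf.expectation (pair_pmf P Q) (\<lambda>z. F (fst z) * G (snd z)) =
         measure_pmf.expectation P F * measure_pmf.expectation Q G"
proof -
  have "measure_pmf.expectation (pair_pmf P Q) (\<lambda>z. F (fst z) * G (snd z)) =
      (\<Sum>z\<in>set_pmf P \<times> set_pmf Q. F (fst z) * G (snd z) * pmf (pair_pmf P Q) z)"
    using assms by (intro integral_measure_pmf_real) auto
  also have "\<dots> = (\<Sum>x\<in>set_pmf P. \<Sum>y\<in>set_pmf Q. (F x * pmf P x) * (G y * pmf Q y))"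
    by (subst sum.cartesian_product) (auto intro!: sum.cong simp: pmf_pair)
  also have "\<dots> = (\<Sum>x\<in>set_pmf P. F x * pmf P x) * (\<Sum>y\<in>set_pmf Q. G y * pmf Q y)"
    by (simp add: sum_product)
  also have "\<dots> = measure_pmf.expectation P F * measure_pmf.expectation Q G"
    using assms by (simp add: integral_measure_pmf_real[of "set_pmf P"] integral_measure_pmf_real[of "set_pmf Q"])
  finally show ?thesis .
qed

text \<open>Copies are indexed by \<open>A\<close> instead of being given as edge sets, so that
  distinct embeddings with the same image stay separate terms. Later \<open>U\<close> is the edge
  set of the complete graph, \<open>A\<close> the embeddings extending a fixed tuple and
  \<open>S\<close> the image of the free edges.\<close>

locale copies =
  fixes U :: "'e set" and p :: real and A :: "'a set" and S :: "'a \<Rightarrow> 'e set"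
  assumes finite_U: "finite U" and p_nonneg: "0 \<le> p" and p_le_1: "p \<le> 1"
    and finite_A: "finite A" and S_subset: "a \<in> A \<Longrightarrow> S a \<subseteq> U"
begin

abbreviation "Om \<equiv> Pi_pmf U False (\<lambda>_. bernoulli_pmf p)"
abbreviation expec :: "(('e \<Rightarrow> bool) \<Rightarrow> real) \<Rightarrow> real" where
  "expec \<equiv> measure_pmf.expectation Om"

definition touch :: "'a \<Rightarrow> 'a set \<Rightarrow> bool" where
  "touch a B \<longleftrightarrow> S a \<inter> \<Union>(S ` B) \<noteq> {}"

definition all_on :: "'e set \<Rightarrow> ('e \<Rightarrow> bool) \<Rightarrow> real" where
  "all_on T f = of_bool (\<forall>e\<in>T. f e)"

definition Y :: "'a \<Rightarrow> ('e \<Rightarrow> bool) \<Rightarrow> real" where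
  "Y a f = all_on (S a) f - p ^ card (S a)"

definition W :: "('e \<Rightarrow> bool) \<Rightarrow> real" where
  "W f = (\<Sum>a\<in>A. Y a f)"

text \<open>The mean number of indices whose edges are all present; it is the scale against which
  every deviation of \<open>W\<close> is measured.\<close>

definition M :: real where "M = (\<Sum>a\<in>A. p ^ card (S a))"

lemma M_nonneg: "0 \<le> M"
  unfolding M_def by (intro sum_nonneg) (simp add: p_nonneg)

lemma finite_set_pmf_Om: "finite (set_pmf Om)"
  by (rule finite_subset[OF set_Pi_pmf_subset'])
     (use finite_U in \<open>auto intro!: finite_PiE_dflt\<close>)

lemma integrable_Om [simp, intro]: "integrable (measure_pmf Om) (g :: _ \<Rightarrow> real)"
  by (rule integrable_measure_pmf_finite[OF finite_set_pmf_Om])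

lemma finite_S: "a \<in> A \<Longrightarrow> finite (S a)"
  using S_subset finite_U finite_subset by blast

lemma expec_mono: "(\<And>f. F f \<le> G f) \<Longrightarrow> expec F \<le> expec G"
  by (intro integral_mono) auto

lemma expec_nonneg: "(\<And>f. 0 \<le> F f) \<Longrightarrow> 0 \<le> expec F"
  by (simp add: integral_nonneg_AE)

text \<open>The product measure is split into its coordinates in \<open>B\<close> and the remaining
  ones; \<open>F\<close> reads only the first component and \<open>G\<close> only the
  second.\<close>

lemma expec_indep:
  assumes F: "\<And>f g. (\<And>e. e \<in> B \<Longrightarrow> f e = g e) \<Longrightarrow> F f = F g"
    and G: "\<And>f g. (\<And>e. e \<in> C \<Longrightarrow> f e = g e) \<Longrightarrow> G f = G g"
    and BC: "B \<inter> C = {}"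
  shows "expec (\<lambda>f. F f * G f) = expec F * expec G"
proof -
  let ?P = "Pi_pmf (U \<inter> B) False (\<lambda>_. bernoulli_pmf p)"
  let ?Q = "Pi_pmf (U - B) False (\<lambda>_. bernoulli_pmf p)"
  let ?h = "\<lambda>(f,g) x. if x \<in> U \<inter> B then f x else g x"
  have fin: "finite (set_pmf ?P)" "finite (set_pmf ?Q)"
    by (rule finite_subset[OF set_Pi_pmf_subset'],
        use finite_U in \<open>auto intro!: finite_PiE_dflt\<close>)+
  have Om: "Om = map_pmf ?h (pair_pmf ?P ?Q)"
  proof -
    have "U = (U \<inter> B) \<union> (U - B)" by blast
    moreover have "Pi_pmf ((U \<inter> B) \<union> (U - B)) False (\<lambda>_. bernoulli_pmf p) = map_pmf ?h (pair_pmf ?P ?Q)"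
      by (rule Pi_pmf_union) (use finite_U in auto)
    ultimately show ?thesis by simp
  qed
  \<comment> \<open>\<open>B\<close> and \<open>C\<close> need not lie inside \<open>U\<close>. A
    sampled function is False outside its index set, so masking with \<open>U\<close> agrees with
    the glued function on all coordinates that \<open>F\<close> or \<open>G\<close> can see.\<close>
  define F' where "F' f = F (\<lambda>x. x \<in> U \<and> f x)" for f
  define G' where "G' f = G (\<lambda>x. x \<in> U \<and> f x)" for f
  have zF: "F (?h z) = F' (fst z)" and zG: "G (?h z) = G' (snd z)"
    if "z \<in> set_pmf (pair_pmf ?P ?Q)" for z
  proof -
    have *: "\<And>x. x \<notin> U - B \<Longrightarrow> \<not> snd z x"
      using that set_Pi_pmf_subset[of "U - B" False "\<lambda>_. bernoulli_pmf p"] finite_U by auto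
    show "F (?h z) = F' (fst z)" unfolding F'_def
      by (rule F) (use * in \<open>auto simp: case_prod_unfold\<close>)
    show "G (?h z) = G' (snd z)" unfolding G'_def
      by (rule G) (use * BC in \<open>auto simp: case_prod_unfold\<close>)
  qed
  have expec_pair: "expec H = measure_pmf.expectation (pair_pmf ?P ?Q) (\<lambda>z. H (?h z))" for H
    by (subst Om) (rule integral_map_pmf)
  have "expec (\<lambda>f. F f * G f) = measure_pmf.expectation (pair_pmf ?P ?Q) (\<lambda>z. F (?h z) * G (?h z))"
    by (rule expec_pair)
  also have "\<dots> = measure_pmf.expectation (pair_pmf ?P ?Q) (\<lambda>z. F' (fst z) * G' (snd z))"
    by (rule integral_cong_AE) (simp, simp, unfold AE_measure_pmf_iff, intro ballI, simp only: zF zG)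
  also have "\<dots> = measure_pmf.expectation ?P F' * measure_pmf.expectation ?Q G'"
    by (rule expectation_pair_pmf_mult[OF fin])
  also have "measure_pmf.expectation ?P F' = measure_pmf.expectation (pair_pmf ?P ?Q) (\<lambda>z. F' (fst z))"
    by simp
  also have "\<dots> = measure_pmf.expectation (pair_pmf ?P ?Q) (\<lambda>z. F (?h z))"
    by (rule integral_cong_AE) (simp, simp, unfold AE_measure_pmf_iff, intro ballI, simp only: zF)
  also have "\<dots> = expec F" by (rule expec_pair[symmetric])
  also have "measure_pmf.expectation ?Q G' = measure_pmf.expectation (pair_pmf ?P ?Q) (\<lambda>z. G' (snd z))"
    by simp
  also have "\<dots> = measure_pmf.expectation (pair_pmf ?P ?Q) (\<lambda>z. G (?h z))"
    by (rule integral_cong_AE) (simp, simp, unfold AE_measure_pmf_iff, intro ballI, simp only: zG)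
  also have "\<dots> = expec G" by (rule expec_pair[symmetric])
  finally show ?thesis .
qed

lemma expec_all_on:
  assumes "T \<subseteq> U"
  shows "expec (all_on T) = p ^ card T"
proof -
  have "expec (all_on T) = measure_pmf.prob Om (Pi U (\<lambda>e. if e \<in> T then {True} else UNIV))"
  proof -
    have "all_on T = indicator (Pi U (\<lambda>e. if e \<in> T then {True} else UNIV))"
      using assms by (auto simp: all_on_def fun_eq_iff indicator_def Pi_def split: if_splits)
    then show ?thesis by simp
  qed
  also have "\<dots> = (\<Prod>e\<in>U. measure_pmf.prob (bernoulli_pmf p) (if e \<in> T then {True} else UNIV))"
    using finite_U by (rule measure_Pi_pmf_Pi)
  also have "\<dots> = (\<Prod>e\<in>U. if e \<in> T then p else 1)"
    using p_nonneg p_le_1 by (intro prod.cong) (auto simp: measure_pmf_single)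
  also have "\<dots> = p ^ card T"
    using assms finite_U by (simp add: prod.If_cases Int_absorb1)
  finally show ?thesis .
qed

lemma all_on_nonneg: "0 \<le> all_on T f" by (simp add: all_on_def)

lemma all_on_Un: "all_on (T \<union> T') f = all_on T f * all_on T' f"
  by (auto simp: all_on_def)

lemma expec_Y: "a \<in> A \<Longrightarrow> expec (Y a) = 0"
  by (simp add: Y_def[abs_def] expec_all_on S_subset)

lemma Y_cong: "(\<And>e. e \<in> S a \<Longrightarrow> f e = g e) \<Longrightarrow> Y a f = Y a g"
  by (simp add: Y_def all_on_def)

lemma pow_card_Un_le:
  assumes "finite T" "finite T'"
  shows "p ^ card T * p ^ card T' \<le> p ^ card (T \<union> T')"
  using card_Un_le[of T T'] p_nonneg p_le_1
  by (simp add: power_add[symmetric] power_decreasing)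

lemma abs_Y_le: "\<bar>Y a f\<bar> \<le> all_on (S a) f + p ^ card (S a)"
  using p_nonneg by (auto simp: Y_def all_on_nonneg abs_if)

text \<open>Expanding the product gives \<open>2 ^ length L\<close> terms, each a choice between
  forcing the edges of \<open>S a\<close> and multiplying by their probability. Both are at most the
  probability weight of the union, the second by \<open>pow_card_Un_le\<close>. The set
  \<open>T\<close> collects the edges forced so far, which makes the induction possible.\<close>

lemma prod_list_bound_aux:
  assumes "set L \<subseteq> A" "T \<subseteq> U"
  shows "expec (\<lambda>f. all_on T f * (\<Prod>a\<leftarrow>L. all_on (S a) f + p ^ card (S a)))
         \<le> 2 ^ length L * p ^ card (T \<union> \<Union>(S ` set L))"
  using assms
proof (induction L arbitrary: T)
  case Nil
  then show ?case by (simp add: expec_all_on)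
next
  case (Cons a L)
  let ?P = "\<lambda>f. (\<Prod>a\<leftarrow>L. all_on (S a) f + p ^ card (S a))"
  let ?V = "\<Union>(S ` set L)"
  have a: "a \<in> A" "S a \<subseteq> U" and L: "set L \<subseteq> A" using Cons.prems S_subset by auto
  have fin: "finite (T \<union> ?V)" "finite (S a)" using Cons.prems L finite_U finite_S a
    by (auto intro: finite_subset)
  have "expec (\<lambda>f. all_on T f * (\<Prod>a\<leftarrow>a#L. all_on (S a) f + p ^ card (S a)))
      = expec (\<lambda>f. all_on (T \<union> S a) f * ?P f + p ^ card (S a) * (all_on T f * ?P f))"
    by (simp add: all_on_Un algebra_simps)
  also have "\<dots> = expec (\<lambda>f. all_on (T \<union> S a) f * ?P f) + p ^ card (S a) * expec (\<lambda>f. all_on T f * ?P f)"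
    by simp
  also have "\<dots> \<le> 2 ^ length L * p ^ card (T \<union> S a \<union> ?V) + p ^ card (S a) * (2 ^ length L * p ^ card (T \<union> ?V))"
    using Cons.IH[of "T \<union> S a"] Cons.IH[of T] Cons.prems L a p_nonneg
    by (intro add_mono mult_left_mono) auto
  also have "\<dots> \<le> 2 ^ length L * p ^ card (T \<union> S a \<union> ?V) + 2 ^ length L * p ^ card (T \<union> S a \<union> ?V)"
  proof -
    have "p ^ card (S a) * p ^ card (T \<union> ?V) \<le> p ^ card (T \<union> S a \<union> ?V)"
      using pow_card_Un_le[OF fin] by (simp add: Un_ac mult.commute)
    from mult_left_mono[OF this, of "2 ^ length L"] show ?thesis by (simp add: mult.left_commute)
  qed
  finally show ?case by (simp add: Un_ac)
qed

lemma expec_abs_prod_Y_le: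
  assumes "set L \<subseteq> A"
  shows "expec (\<lambda>f. \<Prod>a\<leftarrow>L. \<bar>Y a f\<bar>) \<le> 2 ^ length L * p ^ card (\<Union>(S ` set L))"
proof -
  have "(\<Prod>a\<leftarrow>L. \<bar>Y a f\<bar>) \<le> (\<Prod>a\<leftarrow>L. all_on (S a) f + p ^ card (S a))" for f
    by (induction L) (auto intro!: mult_mono abs_Y_le prod_list_nonneg add_nonneg_nonneg
                           simp: all_on_nonneg p_nonneg)
  then have "expec (\<lambda>f. \<Prod>a\<leftarrow>L. \<bar>Y a f\<bar>) \<le> expec (\<lambda>f. all_on {} f * (\<Prod>a\<leftarrow>L. all_on (S a) f + p ^ card (S a)))"
    by (intro expec_mono) (simp add: all_on_def)
  also have "\<dots> \<le> 2 ^ length L * p ^ card ({} \<union> \<Union>(S ` set L))"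
    by (intro prod_list_bound_aux assms) auto
  finally show ?thesis by simp
qed

subsection \<open>Sequences of copies and central moments\<close>

definition seqs :: "nat \<Rightarrow> 'a list set" where
  "seqs m = {L. set L \<subseteq> A \<and> length L = m}"

lemma finite_seqs: "finite (seqs m)"
  unfolding seqs_def by (rule finite_lists_length_eq[OF finite_A])

lemma seqs_0: "seqs 0 = {[]}" by (auto simp: seqs_def)

lemma sum_seqs_Suc: "(\<Sum>L\<in>seqs (Suc m). g L) = (\<Sum>L\<in>seqs m. \<Sum>a\<in>A. g (a # L))"
proof -
  have "seqs (Suc m) = (\<lambda>(L, a). a # L) ` (seqs m \<times> A)"
    by (auto simp: seqs_def length_Suc_conv image_iff)
  moreover have "inj_on (\<lambda>(L, a). a # L) (seqs m \<times> A)"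
    by (auto simp: inj_on_def)
  ultimately show ?thesis
    by (simp add: sum.reindex sum.cartesian_product case_prod_unfold)
qed

lemma W_power: "W f ^ m = (\<Sum>L\<in>seqs m. \<Prod>a\<leftarrow>L. Y a f)"
proof (induction m)
  case 0
  then show ?case by (simp add: seqs_0)
next
  case (Suc m)
  then show ?case
    by (simp add: sum_seqs_Suc W_def sum_distrib_right[symmetric]) (simp add: sum_distrib_left)
qed

text \<open>The number of entries of a sequence, built up from its last entry, that overlap the ones already there.\<close>
fun att :: "'a list \<Rightarrow> nat" where
  "att [] = 0"
| "att (a # L) = of_bool (touch a (set L)) + att L"

lemma att_eq_sum: "att L = (\<Sum>i<length L. of_bool (touch (L ! i) (set (drop (Suc i) L))))"
  by (induction L) (simp_all add: sum.lessThan_Suc_shift del: sum_of_bool_eq sum.lessThan_Suc)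

text \<open>Together with \<open>att_eq_sum\<close> this refers overlaps with later and with earlier
  entries to the same position \<open>i\<close>, so that the two counts can be added position by
  position.\<close>

lemma att_rev_eq_sum: "att (rev L) = (\<Sum>i<length L. of_bool (touch (L ! i) (set (take i L))))"
proof -
  have "att (rev L) = (\<Sum>i<length L. of_bool (touch (L ! (length L - Suc i)) (set (take (length L - Suc i) L))))"
    unfolding att_eq_sum by (rule sum.cong) (auto simp: rev_nth drop_rev)
  also have "\<dots> = (\<Sum>i<length L. of_bool (touch (L ! i) (set (take i L))))"
    by (rule sum.nat_diff_reindex)
  finally show ?thesis .
qed

lemma touch_Un: "touch a (B \<union> C) \<longleftrightarrow> touch a B \<or> touch a C"
  by (auto simp: touch_def)

text \<open>An index touching no other one gives an independent centred factor. If every index touches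
  another one, then it touches an earlier or a later one.\<close>
lemma expec_prod_Y_eq_0:
  assumes "set L \<subseteq> A" "att L + att (rev L) < length L"
  shows "expec (\<lambda>f. \<Prod>a\<leftarrow>L. Y a f) = 0"
proof -
  have "\<exists>i<length L. \<not> touch (L ! i) (set (take i L) \<union> set (drop (Suc i) L))"
  proof (rule ccontr)
    assume "\<not> ?thesis"
    then have "(\<Sum>i<length L. 1) \<le> (\<Sum>i<length L. of_bool (touch (L ! i) (set (drop (Suc i) L)))
        + of_bool (touch (L ! i) (set (take i L))) :: nat)"
      by (intro sum_mono) (auto simp: touch_Un)
    with assms(2) show False
      by (simp add: att_eq_sum[of L] att_rev_eq_sum sum.distrib)
  qed
  then obtain i where i: "i < length L"
    and nt: "\<not> touch (L ! i) (set (take i L) \<union> set (drop (Suc i) L))" by blast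
  define a R where "a = L ! i" and "R = take i L @ drop (Suc i) L"
  have "mset L = mset (a # R)"
    using i unfolding a_def R_def
    by (metis id_take_nth_drop mset.simps(2) mset_append union_mset_add_mset_right)
  then have "(\<Prod>a\<leftarrow>L. Y a f) = Y a f * (\<Prod>b\<leftarrow>R. Y b f)" for f
    by (metis mset_map prod_mset_prod_list list.simps(9) prod_list.Cons)
  then have "expec (\<lambda>f. \<Prod>a\<leftarrow>L. Y a f) = expec (\<lambda>f. Y a f * (\<Prod>b\<leftarrow>R. Y b f))" by simp
  also have "\<dots> = expec (Y a) * expec (\<lambda>f. \<Prod>b\<leftarrow>R. Y b f)"
  proof (rule expec_indep[where B = "S a" and C = "\<Union>(S ` set R)"])
    show "S a \<inter> \<Union>(S ` set R) = {}" using nt by (auto simp: touch_def a_def R_def)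
    show "(\<Prod>b\<leftarrow>R. Y b f) = (\<Prod>b\<leftarrow>R. Y b g)" if "\<And>e. e \<in> \<Union>(S ` set R) \<Longrightarrow> f e = g e" for f g
      using that by (intro arg_cong[where f = prod_list] map_cong refl Y_cong) auto
  qed (rule Y_cong)
  also have "expec (Y a) = 0" using assms(1) i by (intro expec_Y) (auto simp: a_def)
  finally show ?thesis by simp
qed

text \<open>Each new entry multiplies the sum by at most \<open>2 * M\<close>. Entries that touch
  nothing so far contribute at most \<open>M\<close>; touching ones have total new weight at most
  \<open>\<theta> * M\<close>, and dividing by \<open>\<theta>\<close> for the overlap restores
  \<open>M\<close>.\<close>

lemma sum_seqs_weight:
  assumes "0 < \<theta>"
    and H: "\<And>L. set L \<subseteq> A \<Longrightarrow> length L < m \<Longrightarrow>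
       (\<Sum>a | a \<in> A \<and> touch a (set L). p ^ card (S a - \<Union>(S ` set L))) \<le> \<theta> * M"
  shows "(\<Sum>L\<in>seqs m. p ^ card (\<Union>(S ` set L)) / \<theta> ^ att L) \<le> (2 * M) ^ m"
  using H
proof (induction m)
  case 0
  then show ?case by (simp add: seqs_0)
next
  case (Suc m)
  have step: "(\<Sum>a\<in>A. p ^ card (\<Union>(S ` set (a#L))) / \<theta> ^ att (a#L))
       \<le> p ^ card (\<Union>(S ` set L)) / \<theta> ^ att L * (2 * M)" if L: "L \<in> seqs m" for L
  proof -
    let ?V = "\<Union>(S ` set L)"
    have finV: "finite ?V" using L finite_S by (auto simp: seqs_def)
    have "card (\<Union>(S ` set (a#L))) = card ?V + card (S a - ?V)" if "a \<in> A" for a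
      using card_Un_disjoint[of ?V "S a - ?V"] finV finite_S[OF that] by (simp add: Un_commute)
    then have "(\<Sum>a\<in>A. p ^ card (\<Union>(S ` set (a#L))) / \<theta> ^ att (a#L))
       = (\<Sum>a\<in>A. p ^ card ?V / \<theta> ^ att L * (p ^ card (S a - ?V) / \<theta> ^ of_bool (touch a (set L))))"
      by (intro sum.cong) (auto simp: power_add)
    also have "\<dots> = p ^ card ?V / \<theta> ^ att L * (\<Sum>a\<in>A. p ^ card (S a - ?V) / \<theta> ^ of_bool (touch a (set L)))"
      by (simp add: sum_distrib_left)
    also have "(\<Sum>a\<in>A. p ^ card (S a - ?V) / \<theta> ^ of_bool (touch a (set L)))
       = (\<Sum>a | a \<in> A \<and> touch a (set L). p ^ card (S a - ?V) / \<theta>)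
       + (\<Sum>a | a \<in> A \<and> \<not> touch a (set L). p ^ card (S a - ?V))"
    proof -
      have "(\<Sum>a\<in>A. p ^ card (S a - ?V) / \<theta> ^ of_bool (touch a (set L)))
       = (\<Sum>a\<in>A. if touch a (set L) then p ^ card (S a - ?V) / \<theta> else p ^ card (S a - ?V))"
        by (intro sum.cong) auto
      then show ?thesis by (simp add: sum.If_cases finite_A Int_def Collect_neg_eq[symmetric])
    qed
    also have "\<dots> \<le> M + M"
    proof (rule add_mono)
      show "(\<Sum>a | a \<in> A \<and> touch a (set L). p ^ card (S a - ?V) / \<theta>) \<le> M"
        using Suc.prems[of L] L \<open>0 < \<theta>\<close>
        by (simp add: seqs_def sum_divide_distrib[symmetric] divide_le_eq mult.commute)
      have "(\<Sum>a | a \<in> A \<and> \<not> touch a (set L). p ^ card (S a - ?V))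
          = (\<Sum>a | a \<in> A \<and> \<not> touch a (set L). p ^ card (S a))"
        by (intro sum.cong refl arg_cong[where f = "\<lambda>X. p ^ card X"]) (auto simp: touch_def)
      also have "\<dots> \<le> M" unfolding M_def
        by (intro sum_mono2 finite_A) (auto simp: p_nonneg)
      finally show "(\<Sum>a | a \<in> A \<and> \<not> touch a (set L). p ^ card (S a - ?V)) \<le> M" .
    qed
    finally show ?thesis using p_nonneg \<open>0 < \<theta>\<close>
      by (simp add: mult_left_mono divide_simps)
  qed
  have "(\<Sum>L\<in>seqs (Suc m). p ^ card (\<Union>(S ` set L)) / \<theta> ^ att L)
      = (\<Sum>L\<in>seqs m. \<Sum>a\<in>A. p ^ card (\<Union>(S ` set (a#L))) / \<theta> ^ att (a#L))"
    by (rule sum_seqs_Suc)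
  also have "\<dots> \<le> (\<Sum>L\<in>seqs m. p ^ card (\<Union>(S ` set L)) / \<theta> ^ att L * (2 * M))"
    by (intro sum_mono step)
  also have "\<dots> = (\<Sum>L\<in>seqs m. p ^ card (\<Union>(S ` set L)) / \<theta> ^ att L) * (2 * M)"
    by (simp add: sum_distrib_right)
  also have "\<dots> \<le> (2 * M) ^ m * (2 * M)"
    using Suc.IH Suc.prems M_nonneg by (intro mult_right_mono) auto
  finally show ?case by (simp add: mult.commute)
qed

text \<open>A Markov-type step: on sequences with \<open>j \<le> att L\<close> the factor
  \<open>\<theta> ^ j / \<theta> ^ att L\<close> is at least 1, so the weighted sum dominates the
  restricted one.\<close>

lemma sum_seqs_att_ge:
  assumes "0 < \<theta>" "\<theta> \<le> 1"
    and H: "\<And>L. set L \<subseteq> A \<Longrightarrow> length L < m \<Longrightarrow>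
       (\<Sum>a | a \<in> A \<and> touch a (set L). p ^ card (S a - \<Union>(S ` set L))) \<le> \<theta> * M"
  shows "(\<Sum>L | L \<in> seqs m \<and> j \<le> att L. p ^ card (\<Union>(S ` set L))) \<le> (2 * M) ^ m * \<theta> ^ j"
proof -
  have "(\<Sum>L | L \<in> seqs m \<and> j \<le> att L. p ^ card (\<Union>(S ` set L)))
      \<le> (\<Sum>L | L \<in> seqs m \<and> j \<le> att L. \<theta> ^ j * (p ^ card (\<Union>(S ` set L)) / \<theta> ^ att L))"
  proof (intro sum_mono)
    fix L assume "L \<in> {L. L \<in> seqs m \<and> j \<le> att L}"
    then have "\<theta> ^ att L \<le> \<theta> ^ j" using assms by (intro power_decreasing) auto
    then have "1 \<le> \<theta> ^ j / \<theta> ^ att L" using assms by simp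
    from mult_right_mono[OF this, of "p ^ card (\<Union>(S ` set L))"]
    show "p ^ card (\<Union>(S ` set L)) \<le> \<theta> ^ j * (p ^ card (\<Union>(S ` set L)) / \<theta> ^ att L)"
      using p_nonneg by simp
  qed
  also have "\<dots> \<le> (\<Sum>L \<in> seqs m. \<theta> ^ j * (p ^ card (\<Union>(S ` set L)) / \<theta> ^ att L))"
    using assms p_nonneg by (intro sum_mono2 finite_seqs) auto
  also have "\<dots> = \<theta> ^ j * (\<Sum>L \<in> seqs m. p ^ card (\<Union>(S ` set L)) / \<theta> ^ att L)"
    by (simp add: sum_distrib_left)
  also have "\<dots> \<le> \<theta> ^ j * (2 * M) ^ m"
    using assms by (intro mult_left_mono sum_seqs_weight) auto
  finally show ?thesis by (simp add: mult.commute)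
qed

text \<open>A term with nonzero expectation has \<open>att L + att (rev L)\<close> at least
  \<open>2 * k\<close>, so one of the two is at least \<open>k\<close>. Reversal maps one case onto
  the other, hence the factor 2. Of the power of 4, one half comes from
  \<open>expec_abs_prod_Y_le\<close> and the other from \<open>sum_seqs_weight\<close>.\<close>

lemma expec_W_even_power_le:
  assumes "0 < \<theta>" "\<theta> \<le> 1"
    and H: "\<And>L. set L \<subseteq> A \<Longrightarrow> length L < 2 * k \<Longrightarrow>
       (\<Sum>a | a \<in> A \<and> touch a (set L). p ^ card (S a - \<Union>(S ` set L))) \<le> \<theta> * M"
  shows "expec (\<lambda>f. W f ^ (2 * k)) \<le> 2 * 4 ^ (2 * k) * M ^ (2 * k) * \<theta> ^ k"
proof -
  let ?w = "\<lambda>L. p ^ card (\<Union>(S ` set L))"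
  let ?m = "2 * k"
  have "expec (\<lambda>f. W f ^ ?m) = (\<Sum>L\<in>seqs ?m. expec (\<lambda>f. \<Prod>a\<leftarrow>L. Y a f))"
    by (simp add: W_power)
  also have "\<dots> \<le> (\<Sum>L\<in>seqs ?m. 2 ^ ?m * ((if k \<le> att L then ?w L else 0) + (if k \<le> att (rev L) then ?w L else 0)))"
  proof (intro sum_mono)
    fix L assume L: "L \<in> seqs ?m"
    show "expec (\<lambda>f. \<Prod>a\<leftarrow>L. Y a f) \<le> 2 ^ ?m * ((if k \<le> att L then ?w L else 0) + (if k \<le> att (rev L) then ?w L else 0))"
    proof (cases "att L + att (rev L) < length L")
      case True
      then show ?thesis using expec_prod_Y_eq_0[of L] L p_nonneg by (auto simp: seqs_def)
    next
      case False
      then have *: "k \<le> att L \<or> k \<le> att (rev L)" using L by (auto simp: seqs_def)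
      have "(\<Prod>a\<leftarrow>L. Y a f) \<le> (\<Prod>a\<leftarrow>L. \<bar>Y a f\<bar>)" for f
      proof -
        have "\<bar>\<Prod>a\<leftarrow>L. Y a f\<bar> = (\<Prod>a\<leftarrow>L. \<bar>Y a f\<bar>)" by (induction L) (auto simp: abs_mult)
        then show ?thesis by linarith
      qed
      then have "expec (\<lambda>f. \<Prod>a\<leftarrow>L. Y a f) \<le> expec (\<lambda>f. \<Prod>a\<leftarrow>L. \<bar>Y a f\<bar>)" by (rule expec_mono)
      also have "\<dots> \<le> 2 ^ ?m * ?w L" using expec_abs_prod_Y_le[of L] L by (auto simp: seqs_def)
      also have "\<dots> \<le> 2 ^ ?m * ((if k \<le> att L then ?w L else 0) + (if k \<le> att (rev L) then ?w L else 0))"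
        using * p_nonneg by (intro mult_left_mono) auto
      finally show ?thesis .
    qed
  qed
  also have "\<dots> = 2 ^ ?m * ((\<Sum>L | L \<in> seqs ?m \<and> k \<le> att L. ?w L)
       + (\<Sum>L | L \<in> seqs ?m \<and> k \<le> att (rev L). ?w L))"
    by (simp add: sum.distrib sum_distrib_left[symmetric] sum.If_cases finite_seqs Int_def)
  also have "(\<Sum>L | L \<in> seqs ?m \<and> k \<le> att (rev L). ?w L) = (\<Sum>L | L \<in> seqs ?m \<and> k \<le> att L. ?w L)"
    by (rule sum.reindex_bij_witness[of _ rev rev]) (auto simp: seqs_def)
  also have "2 ^ ?m * ((\<Sum>L | L \<in> seqs ?m \<and> k \<le> att L. ?w L) + (\<Sum>L | L \<in> seqs ?m \<and> k \<le> att L. ?w L))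
      \<le> 2 ^ ?m * ((2 * M) ^ ?m * \<theta> ^ k + (2 * M) ^ ?m * \<theta> ^ k)"
    using sum_seqs_att_ge[OF assms] by (intro mult_left_mono add_mono) auto
  also have "\<dots> = 2 * 4 ^ (2 * k) * M ^ (2 * k) * \<theta> ^ k"
  proof -
    have "(4::real) ^ ?m = 2 ^ ?m * 2 ^ ?m" by (simp flip: power_mult_distrib)
    then show ?thesis by (simp only: power_mult_distrib) (simp only: algebra_simps mult_2)
  qed
  finally show ?thesis .
qed

end

subsection \<open>Anticoncentration by Stein's method\<close>

text \<open>The mean value theorem gives the derivative at a point z between x and y. The derivative
  is Lipschitz with constant 1, because |x + z| is at most (1 + x^2)(1 + z^2), so moving it from z
  to x costs one further factor |x - y|.\<close>

lemma arctan_Taylor_bound: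
  fixes x y :: real
  shows "\<bar>arctan x - arctan y - (x - y) / (1 + x\<^sup>2)\<bar> \<le> (x - y)\<^sup>2"
proof (cases "x = y")
  case False
  have "\<exists>z. \<bar>x - z\<bar> \<le> \<bar>x - y\<bar> \<and> arctan x - arctan y = (x - y) / (1 + z\<^sup>2)"
  proof (cases "x < y")
    case True
    have "\<exists>z>x. z < y \<and> arctan y - arctan x = (y - x) * inverse (1 + z\<^sup>2)"
      by (rule MVT2[OF True]) (rule DERIV_arctan)
    then obtain z where "x < z" "z < y" "arctan y - arctan x = (y - x) * inverse (1 + z\<^sup>2)" by blast
    then show ?thesis by (intro exI[of _ z]) (auto simp: divide_inverse algebra_simps)
  next
    case nl: False
    with False have "y < x" by simp
    have "\<exists>z>y. z < x \<and> arctan x - arctan y = (x - y) * inverse (1 + z\<^sup>2)"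
      by (rule MVT2[OF \<open>y < x\<close>]) (rule DERIV_arctan)
    then obtain z where "y < z" "z < x" "arctan x - arctan y = (x - y) * inverse (1 + z\<^sup>2)" by blast
    then show ?thesis by (intro exI[of _ z]) (auto simp: field_simps)
  qed
  then obtain z where z: "\<bar>x - z\<bar> \<le> \<bar>x - y\<bar>" and eq: "arctan x - arctan y = (x - y) / (1 + z\<^sup>2)"
    by blast
  have pos: "0 < 1 + x\<^sup>2" "0 < 1 + z\<^sup>2" by (auto intro: add_pos_nonneg)
  have ab: "2 * \<bar>t\<bar> \<le> 1 + t\<^sup>2" for t :: real
    using zero_le_power2[of "\<bar>t\<bar> - 1"] by (simp add: power2_eq_square algebra_simps)
  have "\<bar>x + z\<bar> \<le> \<bar>x\<bar> + \<bar>z\<bar>" by (rule abs_triangle_ineq)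
  also have "\<dots> \<le> 1 + x\<^sup>2 + z\<^sup>2" using ab[of x] ab[of z] zero_le_power2[of x] zero_le_power2[of z] by linarith
  also have "\<dots> \<le> (1 + x\<^sup>2) * (1 + z\<^sup>2)" by (simp add: algebra_simps)
  finally have xz: "\<bar>x + z\<bar> / ((1 + x\<^sup>2) * (1 + z\<^sup>2)) \<le> 1" using pos by (simp add: divide_le_eq)
  have "1 / (1 + z\<^sup>2) - 1 / (1 + x\<^sup>2) = (x - z) * ((x + z) / ((1 + x\<^sup>2) * (1 + z\<^sup>2)))"
    using pos by (simp add: divide_simps) (simp add: algebra_simps power2_eq_square)
  then have "\<bar>1 / (1 + z\<^sup>2) - 1 / (1 + x\<^sup>2)\<bar> = \<bar>x - z\<bar> * (\<bar>x + z\<bar> / ((1 + x\<^sup>2) * (1 + z\<^sup>2)))"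
    using pos by (simp add: abs_mult)
  also have "\<dots> \<le> \<bar>x - y\<bar> * 1" using z xz pos by (intro mult_mono) auto
  finally have *: "\<bar>1 / (1 + z\<^sup>2) - 1 / (1 + x\<^sup>2)\<bar> \<le> \<bar>x - y\<bar>" by simp
  have "arctan x - arctan y - (x - y) / (1 + x\<^sup>2) = (x - y) * (1 / (1 + z\<^sup>2) - 1 / (1 + x\<^sup>2))"
    by (simp add: eq algebra_simps)
  then have "\<bar>arctan x - arctan y - (x - y) / (1 + x\<^sup>2)\<bar> = \<bar>x - y\<bar> * \<bar>1 / (1 + z\<^sup>2) - 1 / (1 + x\<^sup>2)\<bar>"
    by (simp add: abs_mult)
  also have "\<dots> \<le> \<bar>x - y\<bar> * \<bar>x - y\<bar>" using * by (intro mult_left_mono) auto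
  finally show ?thesis by (simp add: power2_eq_square flip: abs_mult)
qed simp

context copies
begin

text \<open>The variance of \<open>\<bar>Z f\<bar>\<close> is nonnegative.\<close>

lemma expec_abs_le_sqrt: "expec (\<lambda>f. \<bar>Z f\<bar>) \<le> sqrt (expec (\<lambda>f. (Z f)\<^sup>2))"
proof -
  define m where "m = expec (\<lambda>f. \<bar>Z f\<bar>)"
  have "0 \<le> expec (\<lambda>f. (\<bar>Z f\<bar> - m)\<^sup>2)" by (rule expec_nonneg) simp
  also have "\<dots> = expec (\<lambda>f. (Z f)\<^sup>2 - 2 * m * \<bar>Z f\<bar> + m\<^sup>2)"
    by (simp add: power2_diff algebra_simps)
  also have "\<dots> = expec (\<lambda>f. (Z f)\<^sup>2) - 2 * m * m + m\<^sup>2"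
    by (simp add: m_def)
  finally have "m\<^sup>2 \<le> expec (\<lambda>f. (Z f)\<^sup>2)" by (simp add: power2_eq_square)
  then show ?thesis unfolding m_def by (rule real_le_rsqrt)
qed

lemma prob_eq_expec: "measure_pmf.prob Om {f. P f} = expec (\<lambda>f. of_bool (P f))"
proof -
  have "(\<lambda>f. of_bool (P f) :: real) = indicator {f. P f}" by (auto simp: indicator_def)
  then show ?thesis by simp
qed

lemma prob_abs_W_ge:
  assumes "0 < t"
  shows "measure_pmf.prob Om {f. t \<le> \<bar>W f\<bar>} \<le> expec (\<lambda>f. W f ^ (2 * k)) / t ^ (2 * k)"
proof -
  have "of_bool (t \<le> \<bar>W f\<bar>) \<le> W f ^ (2 * k) / t ^ (2 * k)" for f
  proof (cases "t \<le> \<bar>W f\<bar>")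
    case True
    then have "t ^ (2 * k) \<le> \<bar>W f\<bar> ^ (2 * k)" using assms by (intro power_mono) auto
    then show ?thesis using assms True by (simp add: power_even_abs)
  qed (simp add: power_mult)
  from expec_mono[OF this] show ?thesis by (simp add: prob_eq_expec)
qed

text \<open>The dependency neighbourhood in Stein's method. An \<open>a\<close> in \<open>A\<close>
  with nonempty \<open>S a\<close> is its own neighbour, so \<open>D a\<close> then includes
  \<open>Y a\<close>.\<close>

definition nb :: "'a \<Rightarrow> 'a set" where "nb a = {b \<in> A. S a \<inter> S b \<noteq> {}}"

definition D :: "'a \<Rightarrow> ('e \<Rightarrow> bool) \<Rightarrow> real" where "D a f = (\<Sum>b\<in>nb a. Y b f)"

text \<open>\<open>W - D a\<close> is independent of \<open>Y a\<close>, and \<open>T\<close> is the factor of \<open>g' (W)\<close> in Stein's identity.\<close>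
definition T :: "('e \<Rightarrow> bool) \<Rightarrow> real" where "T f = (\<Sum>a\<in>A. Y a f * D a f)"

lemma nb_subset: "nb a \<subseteq> A" and finite_nb: "finite (nb a)"
  using finite_A by (auto simp: nb_def)

text \<open>This removes the zeroth-order Taylor term in Stein's identity. It is applied with the
  identity to compute the variance and with the scaled arctangent to derive
  anticoncentration.\<close>

lemma expec_Y_nonneighbours:
  assumes "a \<in> A"
  shows "expec (\<lambda>f. Y a f * \<phi> (W f - D a f)) = 0"
proof -
  have WD: "W f - D a f = (\<Sum>b\<in>A - nb a. Y b f)" for f
    unfolding W_def D_def using finite_A nb_subset by (simp add: sum_diff)
  have "expec (\<lambda>f. Y a f * \<phi> (W f - D a f)) = expec (Y a) * expec (\<lambda>f. \<phi> (W f - D a f))"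
  proof (rule expec_indep[where B = "S a" and C = "\<Union>(S ` (A - nb a))"])
    show "S a \<inter> \<Union>(S ` (A - nb a)) = {}" by (auto simp: nb_def)
    show "\<phi> (W f - D a f) = \<phi> (W g - D a g)" if "\<And>e. e \<in> \<Union>(S ` (A - nb a)) \<Longrightarrow> f e = g e" for f g
      unfolding WD using that by (intro arg_cong[where f = \<phi>] sum.cong refl Y_cong) auto
  qed (rule Y_cong)
  then show ?thesis by (simp add: expec_Y assms)
qed

text \<open>Since \<open>W\<close> is centred, the right side is its variance. Replacing
  \<open>T\<close> by the variance in Stein's identity therefore costs only the fluctuation of
  \<open>T\<close> about its own mean.\<close>

lemma expec_T: "expec T = expec (\<lambda>f. (W f)\<^sup>2)"
proof -
  have "expec (\<lambda>f. (W f)\<^sup>2) = expec (\<lambda>f. \<Sum>a\<in>A. Y a f * W f)"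
    by (simp add: power2_eq_square sum_distrib_right[symmetric] W_def)
  also have "\<dots> = (\<Sum>a\<in>A. expec (\<lambda>f. Y a f * W f))" by simp
  also have "\<dots> = (\<Sum>a\<in>A. expec (\<lambda>f. Y a f * D a f))"
  proof (rule sum.cong[OF refl])
    fix a assume "a \<in> A"
    have "expec (\<lambda>f. Y a f * W f) = expec (\<lambda>f. Y a f * (W f - D a f) + Y a f * D a f)"
      by (simp add: algebra_simps)
    also have "\<dots> = expec (\<lambda>f. Y a f * (W f - D a f)) + expec (\<lambda>f. Y a f * D a f)" by simp
    also have "expec (\<lambda>f. Y a f * (W f - D a f)) = 0"
      using expec_Y_nonneighbours[OF \<open>a \<in> A\<close>, of "\<lambda>x. x"] by simp
    finally show "expec (\<lambda>f. Y a f * W f) = expec (\<lambda>f. Y a f * D a f)" by simp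
  qed
  also have "\<dots> = expec T" by (simp add: T_def[abs_def])
  finally show ?thesis by simp
qed

text \<open>The covariance is the probability weight of the union minus the product of the two
  weights. A shared edge is counted twice in that product, which is therefore at most
  \<open>p\<close> times the weight of the union.\<close>

lemma expec_Y_mult_ge:
  assumes "a \<in> A" "b \<in> nb a"
  shows "(1 - p) * p ^ card (S a \<union> S b) \<le> expec (\<lambda>f. Y a f * Y b f)"
proof -
  have b: "b \<in> A" and ne: "S a \<inter> S b \<noteq> {}" using assms by (auto simp: nb_def)
  let ?q = "p ^ card (S a)" and ?r = "p ^ card (S b)"
  have "expec (\<lambda>f. Y a f * Y b f) = expec (\<lambda>f. all_on (S a \<union> S b) f - ?r * all_on (S a) f - ?q * all_on (S b) f + ?q * ?r)"
    by (simp add: Y_def all_on_Un algebra_simps)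
  also have "\<dots> = p ^ card (S a \<union> S b) - ?q * ?r"
    using S_subset assms b by (simp add: expec_all_on)
  finally have eq: "expec (\<lambda>f. Y a f * Y b f) = p ^ card (S a \<union> S b) - ?q * ?r" .
  have "?q * ?r \<le> p * p ^ card (S a \<union> S b)"
  proof -
    have fin: "finite (S a)" "finite (S b)" using finite_S assms b by auto
    then have "0 < card (S a \<inter> S b)" using ne by (simp add: card_gt_0_iff)
    then have "Suc (card (S a \<union> S b)) \<le> card (S a) + card (S b)"
      using card_Un_Int[OF fin] by linarith
    then have "p ^ (card (S a) + card (S b)) \<le> p ^ Suc (card (S a \<union> S b))"
      using p_nonneg p_le_1 by (intro power_decreasing)
    then show ?thesis by (simp add: power_add)
  qed
  then show ?thesis by (simp add: eq algebra_simps)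
qed

lemma variance_ge:
  "(1 - p) * (\<Sum>a\<in>A. \<Sum>b\<in>nb a. p ^ card (S a \<union> S b)) \<le> expec (\<lambda>f. (W f)\<^sup>2)"
proof -
  have "(1 - p) * (\<Sum>a\<in>A. \<Sum>b\<in>nb a. p ^ card (S a \<union> S b))
     \<le> (\<Sum>a\<in>A. \<Sum>b\<in>nb a. expec (\<lambda>f. Y a f * Y b f))"
    unfolding sum_distrib_left by (intro sum_mono expec_Y_mult_ge)
  also have "\<dots> = expec T"
    by (simp add: T_def[abs_def] D_def sum_distrib_left)
  finally show ?thesis by (simp add: expec_T)
qed

lemma expec_T_square: "expec (\<lambda>f. (T f - expec T)\<^sup>2) =
   (\<Sum>a\<in>A. \<Sum>b\<in>nb a. \<Sum>c\<in>A. \<Sum>d\<in>nb c. expec (\<lambda>f. Y a f * Y b f * (Y c f * Y d f))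
      - expec (\<lambda>f. Y a f * Y b f) * expec (\<lambda>f. Y c f * Y d f))"
proof -
  have T: "T f = (\<Sum>a\<in>A. \<Sum>b\<in>nb a. Y a f * Y b f)" for f
    by (simp add: T_def D_def sum_distrib_left)
  have ET: "expec T = (\<Sum>a\<in>A. \<Sum>b\<in>nb a. expec (\<lambda>f. Y a f * Y b f))"
    by (simp add: T[abs_def])
  have "expec (\<lambda>f. (T f - expec T)\<^sup>2) = expec (\<lambda>f. T f * T f - 2 * expec T * T f + expec T * expec T)"
    by (simp add: power2_eq_square algebra_simps)
  also have "\<dots> = expec (\<lambda>f. T f * T f) - expec T * expec T"
    by simp
  also have "expec (\<lambda>f. T f * T f) = (\<Sum>a\<in>A. \<Sum>b\<in>nb a. \<Sum>c\<in>A. \<Sum>d\<in>nb c. expec (\<lambda>f. Y a f * Y b f * (Y c f * Y d f)))"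
  proof -
    have "expec (\<lambda>f. T f * T f) = expec (\<lambda>f. \<Sum>a\<in>A. \<Sum>b\<in>nb a. Y a f * Y b f * T f)"
      by (subst (1) T) (simp only: sum_distrib_right)
    also have "\<dots> = (\<Sum>a\<in>A. \<Sum>b\<in>nb a. expec (\<lambda>f. Y a f * Y b f * T f))" by simp
    also have "\<dots> = (\<Sum>a\<in>A. \<Sum>b\<in>nb a. \<Sum>c\<in>A. \<Sum>d\<in>nb c. expec (\<lambda>f. Y a f * Y b f * (Y c f * Y d f)))"
      by (simp add: T sum_distrib_left)
    finally show ?thesis .
  qed
  also have "expec T * expec T = (\<Sum>a\<in>A. \<Sum>b\<in>nb a. \<Sum>c\<in>A. \<Sum>d\<in>nb c. expec (\<lambda>f. Y a f * Y b f) * expec (\<lambda>f. Y c f * Y d f))"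
  proof -
    have "expec T * expec T = (\<Sum>a\<in>A. \<Sum>b\<in>nb a. expec (\<lambda>f. Y a f * Y b f) * expec T)"
      by (subst (1) ET) (simp only: sum_distrib_right)
    then show ?thesis by (simp only: ET sum_distrib_left)
  qed
  finally show ?thesis by (simp only: sum_subtractf)
qed

lemma sum_nb: "(\<Sum>b\<in>nb a. g b) = (\<Sum>b\<in>A. if S a \<inter> S b \<noteq> {} then g b else 0)"
  by (simp add: nb_def sum.If_cases finite_A Int_def)

text \<open>The list is written backwards because \<open>att\<close> builds a sequence from its last
  entry: \<open>a\<close> is placed first, then \<open>b\<close>, then \<open>c\<close>.\<close>

lemma sum_seqs_3: "(\<Sum>L\<in>seqs 3. g L) = (\<Sum>a\<in>A. \<Sum>b\<in>A. \<Sum>c\<in>A. g [c,b,a])"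
  by (simp add: numeral_eq_Suc sum_seqs_Suc seqs_0)

lemma sum_seqs_4: "(\<Sum>L\<in>seqs 4. g L) = (\<Sum>a\<in>A. \<Sum>b\<in>A. \<Sum>c\<in>A. \<Sum>d\<in>A. g [d,c,b,a])"
  by (simp add: numeral_eq_Suc sum_seqs_Suc seqs_0)

text \<open>Expanding the square leaves triples in which \<open>b\<close> and \<open>c\<close> both
  overlap \<open>a\<close>, that is, two overlaps and a factor \<open>\<theta>\<^sup>2\<close>. The
  constant is 8 from \<open>expec_abs_prod_Y_le\<close> times 8 from the cube of
  \<open>2 * M\<close>.\<close>

lemma Stein_remainder_le:
  assumes "0 < \<theta>" "\<theta> \<le> 1"
    and H: "\<And>L. set L \<subseteq> A \<Longrightarrow> length L < 3 \<Longrightarrow>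
       (\<Sum>a | a \<in> A \<and> touch a (set L). p ^ card (S a - \<Union>(S ` set L))) \<le> \<theta> * M"
  shows "(\<Sum>a\<in>A. expec (\<lambda>f. \<bar>Y a f\<bar> * (D a f)\<^sup>2)) \<le> 64 * M ^ 3 * \<theta>\<^sup>2"
proof -
  let ?w = "\<lambda>L. p ^ card (\<Union>(S ` set L))"
  have "(\<Sum>a\<in>A. expec (\<lambda>f. \<bar>Y a f\<bar> * (D a f)\<^sup>2))
     \<le> (\<Sum>a\<in>A. \<Sum>b\<in>A. \<Sum>c\<in>A. if 2 \<le> att [c,b,a] then 8 * ?w [c,b,a] else 0)"
  proof (intro sum_mono)
    fix a assume a: "a \<in> A"
    have "\<bar>Y a f\<bar> * (D a f)\<^sup>2 \<le> (\<Sum>b\<in>nb a. \<Sum>c\<in>nb a. \<Prod>x\<leftarrow>[c,b,a]. \<bar>Y x f\<bar>)" for f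
    proof -
      have "(D a f)\<^sup>2 = \<bar>D a f\<bar>\<^sup>2" by simp
      also have "\<dots> \<le> (\<Sum>b\<in>nb a. \<bar>Y b f\<bar>)\<^sup>2"
        unfolding D_def by (intro power_mono sum_abs) auto
      finally have "\<bar>Y a f\<bar> * (D a f)\<^sup>2 \<le> \<bar>Y a f\<bar> * (\<Sum>b\<in>nb a. \<bar>Y b f\<bar>)\<^sup>2"
        by (intro mult_left_mono) auto
      also have "\<dots> = (\<Sum>b\<in>nb a. \<Sum>c\<in>nb a. \<Prod>x\<leftarrow>[c,b,a]. \<bar>Y x f\<bar>)"
        by (simp add: power2_eq_square sum_product) (simp add: sum_distrib_left mult_ac)
      finally show ?thesis .
    qed
    then have "expec (\<lambda>f. \<bar>Y a f\<bar> * (D a f)\<^sup>2) \<le> expec (\<lambda>f. \<Sum>b\<in>nb a. \<Sum>c\<in>nb a. \<Prod>x\<leftarrow>[c,b,a]. \<bar>Y x f\<bar>)"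
      by (rule expec_mono)
    also have "\<dots> = (\<Sum>b\<in>nb a. \<Sum>c\<in>nb a. expec (\<lambda>f. \<Prod>x\<leftarrow>[c,b,a]. \<bar>Y x f\<bar>))"
      by simp
    also have "\<dots> \<le> (\<Sum>b\<in>nb a. \<Sum>c\<in>nb a. 8 * ?w [c,b,a])"
    proof (intro sum_mono)
      fix b c assume "b \<in> nb a" "c \<in> nb a"
      then show "expec (\<lambda>f. \<Prod>x\<leftarrow>[c,b,a]. \<bar>Y x f\<bar>) \<le> 8 * ?w [c,b,a]"
        using expec_abs_prod_Y_le[of "[c,b,a]"] a by (simp add: nb_def)
    qed
    also have "\<dots> \<le> (\<Sum>b\<in>A. \<Sum>c\<in>A. if 2 \<le> att [c,b,a] then 8 * ?w [c,b,a] else 0)"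
      unfolding sum_nb
    proof (intro sum_mono)
      fix b assume "b \<in> A"
      show "(if S a \<inter> S b \<noteq> {} then \<Sum>c\<in>A. if S a \<inter> S c \<noteq> {} then 8 * ?w [c,b,a] else 0 else 0)
         \<le> (\<Sum>c\<in>A. if 2 \<le> att [c,b,a] then 8 * ?w [c,b,a] else 0)"
      proof (cases "S a \<inter> S b \<noteq> {}")
        case True
        then have "touch b {a}" by (auto simp: touch_def)
        moreover have "touch c {b, a}" if "S a \<inter> S c \<noteq> {}" for c using that by (auto simp: touch_def)
        ultimately have "2 \<le> att [c,b,a]" if "S a \<inter> S c \<noteq> {}" for c using that by simp
        moreover have "0 \<le> 8 * ?w [c,b,a]" for c using p_nonneg by simp
        ultimately show ?thesis unfolding if_P[OF True] by (intro sum_mono) (simp del: att.simps list.set)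
      next
        case False
        have "0 \<le> 8 * ?w [c,b,a]" for c using p_nonneg by simp
        then show ?thesis unfolding if_not_P[OF False] by (intro sum_nonneg) (simp del: att.simps list.set)
      qed
    qed
    finally show "expec (\<lambda>f. \<bar>Y a f\<bar> * (D a f)\<^sup>2)
       \<le> (\<Sum>b\<in>A. \<Sum>c\<in>A. if 2 \<le> att [c,b,a] then 8 * ?w [c,b,a] else 0)" .
  qed
  also have "\<dots> = (\<Sum>L\<in>seqs 3. if 2 \<le> att L then 8 * ?w L else 0)"
    by (rule sum_seqs_3[symmetric])
  also have "\<dots> = 8 * (\<Sum>L | L \<in> seqs 3 \<and> 2 \<le> att L. ?w L)"
    by (simp add: sum.If_cases finite_seqs Int_def sum_distrib_left)
  also have "\<dots> \<le> 8 * ((2 * M) ^ 3 * \<theta>\<^sup>2)"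
    by (intro mult_left_mono sum_seqs_att_ge assms) auto
  finally show ?thesis by (simp add: power_mult_distrib)
qed

text \<open>If the two pairs share no edge, the products are independent and the covariance
  vanishes. Otherwise the mixed moment and the product of the two means each cost at most 16 times
  the weight of the union.\<close>

lemma expec_YY_cov_le:
  assumes "a \<in> A" "b \<in> A" "c \<in> A" "d \<in> A"
  shows "expec (\<lambda>f. Y a f * Y b f * (Y c f * Y d f)) - expec (\<lambda>f. Y a f * Y b f) * expec (\<lambda>f. Y c f * Y d f)
    \<le> (if (S a \<union> S b) \<inter> (S c \<union> S d) \<noteq> {} then 32 * p ^ card (S a \<union> S b \<union> (S c \<union> S d)) else 0)"
proof (cases "(S a \<union> S b) \<inter> (S c \<union> S d) = {}")
  case True
  have "expec (\<lambda>f. (Y a f * Y b f) * (Y c f * Y d f)) = expec (\<lambda>f. Y a f * Y b f) * expec (\<lambda>f. Y c f * Y d f)"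
  proof (rule expec_indep[OF _ _ True])
    fix f g :: "'e \<Rightarrow> bool"
    show "Y a f * Y b f = Y a g * Y b g" if "\<And>e. e \<in> S a \<union> S b \<Longrightarrow> f e = g e"
      using that by (intro arg_cong2[where f = "(*)"] Y_cong) blast+
    show "Y c f * Y d f = Y c g * Y d g" if "\<And>e. e \<in> S c \<union> S d \<Longrightarrow> f e = g e"
      using that by (intro arg_cong2[where f = "(*)"] Y_cong) blast+
  qed
  then show ?thesis using True by simp
next
  case False
  have abs: "\<bar>expec F\<bar> \<le> expec (\<lambda>f. \<bar>F f\<bar>)" for F by (rule integral_abs_bound)
  have 4: "\<bar>expec (\<lambda>f. Y a f * Y b f * (Y c f * Y d f))\<bar> \<le> 16 * p ^ card (S a \<union> S b \<union> (S c \<union> S d))"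
    using abs[of "\<lambda>f. Y a f * Y b f * (Y c f * Y d f)"] expec_abs_prod_Y_le[of "[a,b,c,d]"] assms
    by (simp add: abs_mult mult.assoc Un_assoc)
  have 2: "\<bar>expec (\<lambda>f. Y x f * Y y f)\<bar> \<le> 4 * p ^ card (S x \<union> S y)" if "x \<in> A" "y \<in> A" for x y
    using abs[of "\<lambda>f. Y x f * Y y f"] expec_abs_prod_Y_le[of "[x,y]"] that
    by (simp add: abs_mult)
  have "\<bar>expec (\<lambda>f. Y a f * Y b f) * expec (\<lambda>f. Y c f * Y d f)\<bar>
     \<le> (4 * p ^ card (S a \<union> S b)) * (4 * p ^ card (S c \<union> S d))"
    unfolding abs_mult using assms p_nonneg by (intro mult_mono 2) auto
  also have "\<dots> \<le> 16 * p ^ card (S a \<union> S b \<union> (S c \<union> S d))"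
    using pow_card_Un_le[of "S a \<union> S b" "S c \<union> S d"] assms finite_S by simp
  finally show ?thesis using False 4 by simp
qed

text \<open>A nonzero term links the pair \<open>a\<close>, \<open>b\<close> to the pair
  \<open>c\<close>, \<open>d\<close>. Placing \<open>a\<close>, then \<open>b\<close>, then
  whichever of \<open>c\<close> and \<open>d\<close> meets the first pair, then the other, produces
  three overlaps. The two possible orders are summed separately, so the constant is twice 32 times
  16.\<close>

lemma variance_T_le:
  assumes "0 < \<theta>" "\<theta> \<le> 1"
    and H: "\<And>L. set L \<subseteq> A \<Longrightarrow> length L < 4 \<Longrightarrow>
       (\<Sum>a | a \<in> A \<and> touch a (set L). p ^ card (S a - \<Union>(S ` set L))) \<le> \<theta> * M"
  shows "expec (\<lambda>f. (T f - expec T)\<^sup>2) \<le> 1024 * M ^ 4 * \<theta> ^ 3"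
proof -
  let ?w = "\<lambda>L. p ^ card (\<Union>(S ` set L))"
  let ?g = "\<lambda>L. if 3 \<le> att L then 32 * ?w L else 0"
  have "expec (\<lambda>f. (T f - expec T)\<^sup>2) \<le> (\<Sum>a\<in>A. \<Sum>b\<in>A. \<Sum>c\<in>A. \<Sum>d\<in>A. ?g [d,c,b,a] + ?g [c,d,b,a])"
    unfolding expec_T_square
  proof (intro sum_mono)
    fix a assume a: "a \<in> A"
    let ?C = "\<lambda>b c d. expec (\<lambda>f. Y a f * Y b f * (Y c f * Y d f)) - expec (\<lambda>f. Y a f * Y b f) * expec (\<lambda>f. Y c f * Y d f)"
    have "(\<Sum>b\<in>nb a. \<Sum>c\<in>A. \<Sum>d\<in>nb c. ?C b c d)
        = (\<Sum>b\<in>A. \<Sum>c\<in>A. \<Sum>d\<in>A. if S a \<inter> S b \<noteq> {} \<and> S c \<inter> S d \<noteq> {} then ?C b c d else 0)"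
      unfolding sum_nb by (auto intro!: sum.cong)
    also have "\<dots> \<le> (\<Sum>b\<in>A. \<Sum>c\<in>A. \<Sum>d\<in>A. ?g [d,c,b,a] + ?g [c,d,b,a])"
    proof (intro sum_mono)
      fix b c d assume bcd: "b \<in> A" "c \<in> A" "d \<in> A"
      let ?u = "32 * p ^ card (S a \<union> S b \<union> (S c \<union> S d))"
      have u: "?g [d,c,b,a] = (if 3 \<le> att [d,c,b,a] then ?u else 0)"
        "?g [c,d,b,a] = (if 3 \<le> att [c,d,b,a] then ?u else 0)" by (simp_all add: Un_ac)
      have if_ge: "?u \<le> (if P then ?u else 0) + (if Q then ?u else 0)" if "P \<or> Q" for P Q
        using that p_nonneg by auto
      have if_nonneg: "0 \<le> (if P then ?u else 0) + (if Q then ?u else 0)" for P Q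
        using p_nonneg by auto
      show "(if S a \<inter> S b \<noteq> {} \<and> S c \<inter> S d \<noteq> {} then ?C b c d else 0) \<le> ?g [d,c,b,a] + ?g [c,d,b,a]"
      proof (cases "S a \<inter> S b \<noteq> {} \<and> S c \<inter> S d \<noteq> {} \<and> (S a \<union> S b) \<inter> (S c \<union> S d) \<noteq> {}")
        case True
        have 1: "touch b {a}" "touch d {c,b,a}" "touch c {d,b,a}" using True unfolding touch_def by blast+
        have "touch c {b,a} \<or> touch d {b,a}" using True unfolding touch_def by blast
        with 1 have "3 \<le> att [d,c,b,a] \<or> 3 \<le> att [c,d,b,a]" by auto
        then have "?u \<le> ?g [d,c,b,a] + ?g [c,d,b,a]" unfolding u by (rule if_ge)
        then show ?thesis using expec_YY_cov_le[OF a bcd] True by (simp only: if_True simp_thms split: if_splits)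
      next
        case False
        have "0 \<le> ?g [d,c,b,a] + ?g [c,d,b,a]" unfolding u by (rule if_nonneg)
        moreover have "(if S a \<inter> S b \<noteq> {} \<and> S c \<inter> S d \<noteq> {} then ?C b c d else 0) \<le> 0"
        proof (cases "S a \<inter> S b \<noteq> {} \<and> S c \<inter> S d \<noteq> {}")
          case True
          with False have "\<not> (S a \<union> S b) \<inter> (S c \<union> S d) \<noteq> {}" by blast
          from expec_YY_cov_le[OF a bcd, unfolded if_not_P[OF this]] show ?thesis
            unfolding if_P[OF True] .
        qed (simp only: if_False order_refl)
        ultimately show ?thesis by linarith
      qed
    qed
    finally show "(\<Sum>b\<in>nb a. \<Sum>c\<in>A. \<Sum>d\<in>nb c. ?C b c d) \<le> (\<Sum>b\<in>A. \<Sum>c\<in>A. \<Sum>d\<in>A. ?g [d,c,b,a] + ?g [c,d,b,a])" .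
  qed
  also have "\<dots> = (\<Sum>a\<in>A. \<Sum>b\<in>A. \<Sum>c\<in>A. \<Sum>d\<in>A. ?g [d,c,b,a]) + (\<Sum>a\<in>A. \<Sum>b\<in>A. \<Sum>c\<in>A. \<Sum>d\<in>A. ?g [c,d,b,a])"
    by (simp only: sum.distrib)
  also have "(\<Sum>a\<in>A. \<Sum>b\<in>A. \<Sum>c\<in>A. \<Sum>d\<in>A. ?g [c,d,b,a]) = (\<Sum>a\<in>A. \<Sum>b\<in>A. \<Sum>c\<in>A. \<Sum>d\<in>A. ?g [d,c,b,a])"
    by (intro sum.cong refl sum.swap)
  also have "(\<Sum>a\<in>A. \<Sum>b\<in>A. \<Sum>c\<in>A. \<Sum>d\<in>A. ?g [d,c,b,a]) = (\<Sum>L\<in>seqs 4. ?g L)"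
    by (rule sum_seqs_4[symmetric])
  also have "\<dots> = 32 * (\<Sum>L | L \<in> seqs 4 \<and> 3 \<le> att L. ?w L)"
    by (simp add: sum.If_cases finite_seqs Int_def sum_distrib_left)
  also have "32 * (\<Sum>L | L \<in> seqs 4 \<and> 3 \<le> att L. ?w L) + 32 * (\<Sum>L | L \<in> seqs 4 \<and> 3 \<le> att L. ?w L)
      \<le> 32 * ((2 * M) ^ 4 * \<theta> ^ 3) + 32 * ((2 * M) ^ 4 * \<theta> ^ 3)"
    by (intro add_mono mult_left_mono sum_seqs_att_ge assms) auto
  also have "\<dots> = 1024 * M ^ 4 * \<theta> ^ 3" by (simp add: power_mult_distrib)
  finally show ?thesis .
qed

text \<open>Since arctan is bounded by 2, E (W g(W)) is at most twice the standard deviation. Taylor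
  expansion replaces it by E (T g'(W)) at the price of the last term, and g' being at most 1/h
  allows \<open>T\<close> to be replaced by \<open>v\<close> at the price of the middle one. Finally
  g' is at least 1/(2h) where |W| is at most h.\<close>

lemma prob_abs_W_le_Stein:
  assumes h: "0 < h"
  defines "v \<equiv> expec (\<lambda>f. (W f)\<^sup>2)"
  shows "v * measure_pmf.prob Om {f. \<bar>W f\<bar> \<le> h} / (2 * h)
    \<le> 2 * sqrt v + sqrt (expec (\<lambda>f. (T f - expec T)\<^sup>2)) / h + (\<Sum>a\<in>A. expec (\<lambda>f. \<bar>Y a f\<bar> * (D a f)\<^sup>2)) / h\<^sup>2"
proof -
  define g where "g x = arctan (x / h)" for x
  define g' where "g' x = 1 / (1 + (x / h)\<^sup>2) / h" for x
  have g'_pos: "0 \<le> g' x" and g'_le: "g' x \<le> 1 / h" for x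
  proof -
    have "1 / (1 + y) \<le> 1 \<and> 0 \<le> 1 / (1 + y)" if "0 \<le> y" for y :: real using that by simp
    from this[of "(x / h)\<^sup>2"] have "1 / (1 + (x / h)\<^sup>2) \<le> 1" "0 \<le> 1 / (1 + (x / h)\<^sup>2)" by auto
    then show "0 \<le> g' x" "g' x \<le> 1 / h"
      unfolding g'_def using h divide_right_mono[of "1 / (1 + (x / h)\<^sup>2)" 1 h] divide_nonneg_pos by auto
  qed
  have g'_ge: "of_bool (\<bar>x\<bar> \<le> h) / (2 * h) \<le> g' x" for x
  proof (cases "\<bar>x\<bar> \<le> h")
    case True
    then have "(\<bar>x\<bar> / h)\<^sup>2 \<le> 1" using h by (simp add: abs_square_le_1)
    then have "(x / h)\<^sup>2 \<le> 1" by (simp add: power_divide)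
    then have "1 / 2 \<le> 1 / (1 + (x / h)\<^sup>2)" by (intro divide_left_mono) (auto intro!: mult_pos_pos add_pos_nonneg)
    from divide_right_mono[OF this, of h] show ?thesis using True h by (simp add: g'_def)
  qed (simp add: g'_pos)
  have taylor: "\<bar>g x - g y - (x - y) * g' x\<bar> \<le> (x - y)\<^sup>2 / h\<^sup>2" for x y
    using arctan_Taylor_bound[of "x / h" "y / h"] h
    by (simp add: g_def g'_def diff_divide_distrib[symmetric] power_divide mult.commute[of _ h])
  have v0: "0 \<le> v" unfolding v_def by (rule expec_nonneg) simp
  have g_bound: "\<bar>g x\<bar> \<le> 2" for x
    using arctan_bounded[of "x / h"] pi_less_4 unfolding g_def by linarith
  let ?Rem = "\<Sum>a\<in>A. expec (\<lambda>f. \<bar>Y a f\<bar> * (D a f)\<^sup>2)"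
  have Y_step: "expec (\<lambda>f. Y a f * D a f * g' (W f)) - expec (\<lambda>f. \<bar>Y a f\<bar> * (D a f)\<^sup>2) / h\<^sup>2
      \<le> expec (\<lambda>f. Y a f * g (W f))" if a: "a \<in> A" for a
  proof -
    \<comment> \<open>The expansion is centred at \<open>W f\<close> and not at
      \<open>W f - D a f\<close>: the derivative is then the same for every \<open>a\<close>, and
      the first-order terms add up to \<open>T f * g' (W f)\<close>.\<close>
    have pt: "Y a f * D a f * g' (W f) - \<bar>Y a f\<bar> * (D a f)\<^sup>2 / h\<^sup>2 + Y a f * g (W f - D a f) \<le> Y a f * g (W f)" for f
    proof -
      let ?r = "g (W f) - g (W f - D a f) - D a f * g' (W f)"
      have "\<bar>Y a f * ?r\<bar> \<le> \<bar>Y a f\<bar> * ((D a f)\<^sup>2 / h\<^sup>2)"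
        unfolding abs_mult using taylor[of "W f" "W f - D a f"] by (intro mult_left_mono) auto
      then have "- (\<bar>Y a f\<bar> * (D a f)\<^sup>2 / h\<^sup>2) \<le> Y a f * ?r" by (simp add: abs_le_iff)
      then show ?thesis by (simp add: algebra_simps)
    qed
    have "expec (\<lambda>f. Y a f * D a f * g' (W f) - \<bar>Y a f\<bar> * (D a f)\<^sup>2 / h\<^sup>2 + Y a f * g (W f - D a f))
      \<le> expec (\<lambda>f. Y a f * g (W f))" by (rule expec_mono[OF pt])
    moreover have "expec (\<lambda>f. Y a f * g (W f - D a f)) = 0" by (rule expec_Y_nonneighbours[OF a])
    ultimately show ?thesis by simp
  qed
  have "expec (\<lambda>f. T f * g' (W f)) - ?Rem / h\<^sup>2
      = (\<Sum>a\<in>A. expec (\<lambda>f. Y a f * D a f * g' (W f)) - expec (\<lambda>f. \<bar>Y a f\<bar> * (D a f)\<^sup>2) / h\<^sup>2)"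
    by (simp add: T_def sum_distrib_right sum_subtractf sum_divide_distrib)
  also have "\<dots> \<le> (\<Sum>a\<in>A. expec (\<lambda>f. Y a f * g (W f)))" by (intro sum_mono Y_step)
  also have "\<dots> = expec (\<lambda>f. W f * g (W f))" by (simp add: W_def sum_distrib_right)
  also have "\<dots> \<le> expec (\<lambda>f. 2 * \<bar>W f\<bar>)"
  proof (rule expec_mono)
    fix f
    have "W f * g (W f) \<le> \<bar>W f\<bar> * \<bar>g (W f)\<bar>" by (simp flip: abs_mult)
    also have "\<dots> \<le> \<bar>W f\<bar> * 2" by (intro mult_left_mono g_bound) auto
    finally show "W f * g (W f) \<le> 2 * \<bar>W f\<bar>" by simp
  qed
  also have "\<dots> \<le> 2 * sqrt v" using expec_abs_le_sqrt[of W] by (simp add: v_def)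
  finally have 1: "expec (\<lambda>f. T f * g' (W f)) \<le> 2 * sqrt v + ?Rem / h\<^sup>2" by simp
  have "v * measure_pmf.prob Om {f. \<bar>W f\<bar> \<le> h} / (2 * h) = v * expec (\<lambda>f. of_bool (\<bar>W f\<bar> \<le> h) / (2 * h))"
    by (simp add: prob_eq_expec)
  also have "\<dots> \<le> v * expec (\<lambda>f. g' (W f))"
    using v0 by (intro mult_left_mono expec_mono g'_ge)
  also have "\<dots> = expec (\<lambda>f. v * g' (W f))" by simp
  also have "\<dots> \<le> expec (\<lambda>f. T f * g' (W f) + \<bar>T f - v\<bar> / h)"
  proof (rule expec_mono)
    fix f
    have "(v - T f) * g' (W f) \<le> \<bar>T f - v\<bar> * g' (W f)" by (intro mult_right_mono g'_pos) auto
    also have "\<dots> \<le> \<bar>T f - v\<bar> * (1 / h)" by (intro mult_left_mono g'_le) auto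
    finally show "v * g' (W f) \<le> T f * g' (W f) + \<bar>T f - v\<bar> / h" by (simp add: algebra_simps)
  qed
  also have "\<dots> = expec (\<lambda>f. T f * g' (W f)) + expec (\<lambda>f. \<bar>T f - v\<bar>) / h" by simp
  also have "\<dots> \<le> 2 * sqrt v + ?Rem / h\<^sup>2 + sqrt (expec (\<lambda>f. (T f - v)\<^sup>2)) / h"
    using 1 expec_abs_le_sqrt[of "\<lambda>f. T f - v"] h by (intro add_mono divide_right_mono) auto
  finally show ?thesis by (simp add: v_def expec_T)
qed

text \<open>The previous bound at \<open>h = \<eta> * M * sqrt \<theta>\<close>, multiplied by 2h/v.
  The first term is controlled by the choice of \<open>\<eta>\<close>; for fixed
  \<open>\<eta>\<close> and \<open>c\<close> the other two vanish with
  \<open>\<theta>\<close>.\<close>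

lemma prob_abs_W_le:
  assumes \<theta>: "0 < \<theta>" "\<theta> \<le> 1" and M: "0 < M" and \<eta>: "0 < \<eta>" and c: "0 < c"
    and v: "c * M\<^sup>2 * \<theta> \<le> expec (\<lambda>f. (W f)\<^sup>2)"
    and H: "\<And>L. set L \<subseteq> A \<Longrightarrow> length L < 4 \<Longrightarrow>
       (\<Sum>a | a \<in> A \<and> touch a (set L). p ^ card (S a - \<Union>(S ` set L))) \<le> \<theta> * M"
  shows "measure_pmf.prob Om {f. \<bar>W f\<bar> \<le> \<eta> * M * sqrt \<theta>}
    \<le> 4 * \<eta> / sqrt c + 64 * sqrt \<theta> / c + 128 * sqrt \<theta> / (c * \<eta>)"
proof -
  define v where "v = expec (\<lambda>f. (W f)\<^sup>2)"
  \<comment> \<open>In terms of the root \<open>s\<close>, the half-integral powers of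
    \<open>\<theta>\<close> become integral ones.\<close>
  define s where "s = sqrt \<theta>"
  have s: "0 < s" "\<theta> = s\<^sup>2" using \<theta> by (auto simp: s_def)
  define h where "h = \<eta> * M * s"
  have h: "0 < h" using \<eta> M s by (simp add: h_def)
  let ?P = "measure_pmf.prob Om {f. \<bar>W f\<bar> \<le> h}"
  have v1: "c * (M * s)\<^sup>2 \<le> v" using v by (simp add: v_def s power_mult_distrib)
  have Ms: "0 < c * (M * s)\<^sup>2" using c M s by simp
  have v0: "0 < v" using v1 Ms by linarith
  have rem: "(\<Sum>a\<in>A. expec (\<lambda>f. \<bar>Y a f\<bar> * (D a f)\<^sup>2)) \<le> 64 * M ^ 3 * s ^ 4"
    using Stein_remainder_le[OF \<theta> H] by (simp add: s(2) flip: power_mult)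
  have "sqrt (expec (\<lambda>f. (T f - expec T)\<^sup>2)) \<le> sqrt (1024 * M ^ 4 * \<theta> ^ 3)"
    using variance_T_le[OF \<theta> H] by simp
  also have "1024 * M ^ 4 * \<theta> ^ 3 = (32 * M\<^sup>2 * s ^ 3)\<^sup>2"
    by (simp add: s(2) power_mult_distrib flip: power_mult)
  also have "sqrt \<dots> = 32 * M\<^sup>2 * s ^ 3" using M s by simp
  finally have var: "sqrt (expec (\<lambda>f. (T f - expec T)\<^sup>2)) \<le> 32 * M\<^sup>2 * s ^ 3" .
  have "v * ?P / (2 * h) \<le> 2 * sqrt v + 32 * M\<^sup>2 * s ^ 3 / h + 64 * M ^ 3 * s ^ 4 / h\<^sup>2"
    unfolding v_def using rem var h
    by (intro order_trans[OF prob_abs_W_le_Stein[OF h]] add_mono divide_right_mono) auto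
  then have "(2 * h / v) * (v * ?P / (2 * h)) \<le> (2 * h / v) * (2 * sqrt v + 32 * M\<^sup>2 * s ^ 3 / h + 64 * M ^ 3 * s ^ 4 / h\<^sup>2)"
    using h v0 by (intro mult_left_mono) auto
  also have "(2 * h / v) * (v * ?P / (2 * h)) = ?P" using h v0 by simp
  also have "(2 * h / v) * (2 * sqrt v + 32 * M\<^sup>2 * s ^ 3 / h + 64 * M ^ 3 * s ^ 4 / h\<^sup>2) = 4 * h / sqrt v + 64 * M\<^sup>2 * s ^ 3 / v + 128 * M ^ 3 * s ^ 4 / (h * v)"
  proof -
    have "sqrt v / v = 1 / sqrt v" using v0 by (simp add: real_div_sqrt divide_simps)
    moreover have "2 * h / v * (2 * sqrt v) = 4 * h * (sqrt v / v)" by simp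
    ultimately have "2 * h / v * (2 * sqrt v) = 4 * h / sqrt v" by simp
    moreover have "2 * h / v * (32 * M\<^sup>2 * s ^ 3 / h) = 64 * M\<^sup>2 * s ^ 3 / v" using h by simp
    moreover have "2 * h / v * (64 * M ^ 3 * s ^ 4 / h\<^sup>2) = 128 * M ^ 3 * s ^ 4 / (h * v)"
      using h v0 by (simp add: field_simps power2_eq_square)
    ultimately show ?thesis by (simp add: distrib_left)
  qed
  also have "\<dots> \<le> 4 * \<eta> / sqrt c + 64 * s / c + 128 * s / (c * \<eta>)"
  proof (intro add_mono)
    have "sqrt c * (M * s) = sqrt (c * (M * s)\<^sup>2)" using c M s by (simp add: real_sqrt_mult)
    also have "\<dots> \<le> sqrt v" using v1 by simp
    finally have "4 * h / sqrt v \<le> 4 * h / (sqrt c * (M * s))"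
      using h c M s v0 by (intro divide_left_mono) auto
    also have "\<dots> = 4 * \<eta> / sqrt c" using M s by (simp add: h_def)
    finally show "4 * h / sqrt v \<le> 4 * \<eta> / sqrt c" .
    have "64 * M\<^sup>2 * s ^ 3 / v \<le> 64 * M\<^sup>2 * s ^ 3 / (c * (M * s)\<^sup>2)"
      using v1 v0 Ms s by (intro divide_left_mono) auto
    also have "\<dots> = 64 * s / c" using M s c by (simp add: power2_eq_square power3_eq_cube)
    finally show "64 * M\<^sup>2 * s ^ 3 / v \<le> 64 * s / c" .
    have "128 * M ^ 3 * s ^ 4 / (h * v) \<le> 128 * M ^ 3 * s ^ 4 / (h * (c * (M * s)\<^sup>2))"
      using v1 s h M c by (intro divide_left_mono mult_left_mono mult_pos_pos[OF mult_pos_pos[OF h v0] mult_pos_pos[OF h Ms]]) auto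
    also have "\<dots> = 128 * s / (c * \<eta>)" using M s c \<eta>
      by (simp add: h_def power2_eq_square power3_eq_cube power4_eq_xxxx)
    finally show "128 * M ^ 3 * s ^ 4 / (h * v) \<le> 128 * s / (c * \<eta>)" .
  qed
  finally show ?thesis by (simp add: h_def s_def)
qed

end

subsection \<open>Embeddings\<close>

text \<open>The prescribed set \<open>R\<close> is kept general: it is the root set in
  \<open>emb\<close>, but the vertex set of a larger subgraph in \<open>overlap_lower\<close>.
  Extensionality makes maps that agree on \<open>V\<close> equal, so they can be counted.\<close>

definition inj_ext :: "'a set \<Rightarrow> 'a set \<Rightarrow> 'b set \<Rightarrow> ('a \<Rightarrow> 'b) \<Rightarrow> ('a \<Rightarrow> 'b) set" where
  "inj_ext R V N x = {\<phi> \<in> V \<rightarrow>\<^sub>E N. inj_on \<phi> V \<and> (\<forall>v\<in>R. \<phi> v = x v)}"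

lemma finite_inj_ext: "finite V \<Longrightarrow> finite N \<Longrightarrow> finite (inj_ext R V N x)"
  unfolding inj_ext_def by (intro finite_Collect_conjI disjI1) (simp add: finite_PiE)

text \<open>By induction on the free vertices: a further vertex \<open>d\<close> may take any value
  not yet used. Truncated subtraction is harmless, since it produces a zero factor exactly when the
  values run out.\<close>

lemma card_inj_ext_aux:
  assumes "finite D" "finite R" "D \<inter> R = {}" "finite N" "inj_on x R" "x ` R \<subseteq> N"
  shows "card (inj_ext R (R \<union> D) N x) = (\<Prod>i<card D. card N - card R - i)"
  using assms
proof (induction D rule: finite_induct)
  case empty
  have "inj_ext R (R \<union> {}) N x = {restrict x R}"
    using empty.prems by (auto simp: inj_ext_def PiE_def extensional_def fun_eq_iff inj_on_def)
  then show ?case by simp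
next
  case (insert d D)
  let ?V = "R \<union> D"
  let ?S = "SIGMA \<phi>:inj_ext R ?V N x. N - \<phi> ` ?V"
  let ?f = "\<lambda>(\<phi>, y). \<phi>(d := y)"
  have d: "d \<notin> ?V" using insert by auto
  have "bij_betw ?f ?S (inj_ext R (R \<union> insert d D) N x)"
  proof (rule bij_betw_byWitness[where f' = "\<lambda>\<psi>. (restrict \<psi> ?V, \<psi> d)"])
    have dom: "R \<union> insert d D = insert d ?V" by auto
    show "\<forall>z\<in>?S. (restrict (?f z) ?V, (?f z) d) = z"
    proof
      fix z assume "z \<in> ?S"
      then obtain \<phi> y where z: "z = (\<phi>, y)" and "\<phi> \<in> inj_ext R ?V N x" by blast
      then have "restrict \<phi> ?V = \<phi>" by (auto simp: inj_ext_def intro: PiE_restrict)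
      moreover have "restrict (\<phi>(d := y)) ?V = restrict \<phi> ?V"
        using d by (intro restrict_ext) auto
      ultimately show "(restrict (?f z) ?V, (?f z) d) = z" by (simp add: z)
    qed
    show "\<forall>\<psi>\<in>inj_ext R (R \<union> insert d D) N x. ?f (restrict \<psi> ?V, \<psi> d) = \<psi>"
    proof
      fix \<psi> assume "\<psi> \<in> inj_ext R (R \<union> insert d D) N x"
      then have "\<And>v. v \<notin> insert d ?V \<Longrightarrow> \<psi> v = undefined"
        unfolding dom by (auto simp: inj_ext_def PiE_def extensional_def)
      then show "?f (restrict \<psi> ?V, \<psi> d) = \<psi>" by (auto simp: fun_eq_iff)
    qed
    show "?f ` ?S \<subseteq> inj_ext R (R \<union> insert d D) N x"
    proof (rule image_subsetI)
      fix z assume "z \<in> ?S"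
      then obtain \<phi> y where z: "z = (\<phi>, y)" and \<phi>: "\<phi> \<in> inj_ext R ?V N x"
        and y: "y \<in> N" "y \<notin> \<phi> ` ?V" by blast
      have 1: "\<phi> \<in> ?V \<rightarrow>\<^sub>E N" "inj_on \<phi> ?V" "\<And>v. v \<in> R \<Longrightarrow> \<phi> v = x v"
        using \<phi> by (simp_all add: inj_ext_def)
      have "\<phi>(d := y) \<in> insert d ?V \<rightarrow>\<^sub>E N" using y(1) 1(1) by (rule PiE_fun_upd)
      moreover have "inj_on (\<phi>(d := y)) (insert d ?V)"
        using d 1(2) y(2) by (auto simp: inj_on_def)
      moreover have "(\<phi>(d := y)) v = x v" if "v \<in> R" for v using that d 1(3) by auto
      ultimately show "?f z \<in> inj_ext R (R \<union> insert d D) N x"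
        unfolding dom z by (simp add: inj_ext_def)
    qed
    show "(\<lambda>\<psi>. (restrict \<psi> ?V, \<psi> d)) ` inj_ext R (R \<union> insert d D) N x \<subseteq> ?S"
    proof (rule image_subsetI)
      fix \<psi> assume \<psi>: "\<psi> \<in> inj_ext R (R \<union> insert d D) N x"
      have 1: "\<psi> \<in> insert d ?V \<rightarrow>\<^sub>E N" "inj_on \<psi> (insert d ?V)" "\<And>v. v \<in> R \<Longrightarrow> \<psi> v = x v"
        using \<psi> unfolding dom by (simp_all add: inj_ext_def)
      have "restrict \<psi> ?V \<in> ?V \<rightarrow>\<^sub>E N" using 1(1) by auto
      moreover have "inj_on \<psi> ?V" using 1(2) by (rule inj_on_subset) auto
      moreover have "\<psi> d \<notin> \<psi> ` ?V" using 1(2) d by (auto simp: inj_on_def)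
      moreover have "\<psi> d \<in> N" using 1(1) by auto
      moreover have "restrict \<psi> ?V ` ?V = \<psi> ` ?V" by (rule image_restrict_eq)
      ultimately show "(restrict \<psi> ?V, \<psi> d) \<in> ?S" using 1(3) by (simp add: inj_ext_def)
    qed
  qed
  then have "card (inj_ext R (R \<union> insert d D) N x) = card ?S" by (simp add: bij_betw_same_card)
  also have "\<dots> = (\<Sum>\<phi>\<in>inj_ext R ?V N x. card (N - \<phi> ` ?V))"
    using insert by (intro card_SigmaI finite_inj_ext ballI) auto
  also have "\<dots> = (\<Sum>\<phi>\<in>inj_ext R ?V N x. card N - card R - card D)"
  proof (rule sum.cong[OF refl])
    fix \<phi> assume \<phi>: "\<phi> \<in> inj_ext R ?V N x"
    then have "card (\<phi> ` ?V) = card R + card D"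
      using insert by (subst card_image) (auto simp: inj_ext_def card_Un_disjoint Int_commute)
    moreover have "\<phi> ` ?V \<subseteq> N" using \<phi> by (auto simp: inj_ext_def PiE_def)
    ultimately show "card (N - \<phi> ` ?V) = card N - card R - card D"
      using insert by (simp add: card_Diff_subset)
  qed
  also have "\<dots> = (\<Prod>i<card D. card N - card R - i) * (card N - card R - card D)"
    using insert by simp
  finally show ?case using insert by simp
qed

lemma card_inj_ext:
  assumes "finite V" "R \<subseteq> V" "finite N" "inj_on x R" "x ` R \<subseteq> N"
  shows "card (inj_ext R V N x) = (\<Prod>i<card (V - R). card N - card R - i)"
proof -
  have "V = R \<union> (V - R)" using assms by auto
  then show ?thesis
    using card_inj_ext_aux[of "V - R" R N x] assms by (metis Diff_disjoint Int_commute finite_Diff finite_subset)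
qed

lemma card_inj_ext_le:
  assumes "finite V" "R \<subseteq> V" "finite N" "inj_on x R" "x ` R \<subseteq> N"
  shows "card (inj_ext R V N x) \<le> card N ^ card (V - R)"
proof -
  have "(\<Prod>i<card (V - R). card N - card R - i) \<le> (\<Prod>i<card (V - R). card N)"
    by (intro prod_mono) auto
  then show ?thesis using card_inj_ext[OF assms] by simp
qed

text \<open>At most \<open>card V\<close> values are excluded at any stage, so at least half of
  \<open>N\<close> remains for each vertex.\<close>

lemma card_inj_ext_ge:
  assumes "finite V" "R \<subseteq> V" "finite N" "inj_on x R" "x ` R \<subseteq> N" "2 * card V \<le> card N"
  shows "(real (card N) / 2) ^ card (V - R) \<le> card (inj_ext R V N x)"
proof -
  have "(\<Prod>i<card (V - R). real (card N) / 2) \<le> (\<Prod>i<card (V - R). real (card N - card R - i))"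
  proof (intro prod_mono conjI)
    fix i assume "i \<in> {..<card (V - R)}"
    then have "card R + i \<le> card V" using assms by (auto simp: card_Diff_subset finite_subset)
    then show "real (card N) / 2 \<le> real (card N - card R - i)" using assms(6) by linarith
  qed simp
  then show ?thesis using card_inj_ext[OF assms(1-5)] by simp
qed

definition free_edges :: "nat \<Rightarrow> nat set set \<Rightarrow> nat set set" where
  "free_edges vG EH = EH - root_edges vG EH"

definition emb :: "nat \<Rightarrow> nat set \<Rightarrow> nat \<Rightarrow> (nat \<Rightarrow> nat) \<Rightarrow> (nat \<Rightarrow> nat) set" where
  "emb vG V n x = inj_ext {1..vG} V {1..n} x"

definition edge_image :: "nat set set \<Rightarrow> (nat \<Rightarrow> nat) \<Rightarrow> nat set set" where
  "edge_image EE \<phi> = (`) \<phi> ` EE"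

lemma finite_all_edges: "finite V \<Longrightarrow> finite (all_edges V)"
  unfolding all_edges_def by (rule finite_subset[of _ "Pow V"]) auto

lemma finite_emb: "finite V \<Longrightarrow> finite (emb vG V n x)"
  by (simp add: emb_def finite_inj_ext)

lemma edge_image_subset:
  assumes "\<phi> \<in> emb vG V n x" "EE \<subseteq> all_edges V"
  shows "edge_image EE \<phi> \<subseteq> all_edges {1..n}"
proof
  fix g assume "g \<in> edge_image EE \<phi>"
  then obtain e where e: "e \<in> EE" "g = \<phi> ` e" by (auto simp: edge_image_def)
  with assms have "e \<subseteq> V" "card e = 2" "inj_on \<phi> V" "\<phi> ` V \<subseteq> {1..n}"
    by (auto simp: all_edges_def emb_def inj_ext_def PiE_def)
  then show "g \<in> all_edges {1..n}"
    using e card_image[of \<phi> e] by (auto simp: all_edges_def inj_on_subset)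
qed

lemma inj_on_image_edges:
  assumes "inj_on \<phi> V" "EE \<subseteq> all_edges V"
  shows "inj_on ((`) \<phi>) EE"
  using inj_on_subset[OF inj_on_image_Pow[OF assms(1)]] assms(2) by (auto simp: all_edges_def)

lemma card_edge_image:
  assumes "\<phi> \<in> emb vG V n x" "EE \<subseteq> all_edges V"
  shows "card (edge_image EE \<phi>) = card EE"
  unfolding edge_image_def using assms
  by (intro card_image inj_on_image_edges) (auto simp: emb_def inj_ext_def)

lemma copies_emb:
  assumes "finite V" "EE \<subseteq> all_edges V" "0 \<le> p" "p \<le> 1"
  shows "copies (all_edges {1..n}) p (emb vG V n x) (edge_image EE)"
  using assms edge_image_subset[OF _ assms(2)]
  by unfold_locales (simp_all add: finite_all_edges finite_emb)

subsection \<open>Copies versus embeddings\<close>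

text \<open>The symmetries by which an embedding may be changed without changing the extension it
  represents. They need to preserve only the free edges, since an extension contains no images of
  edges of the root graph.\<close>

definition root_auts :: "nat \<Rightarrow> nat set \<Rightarrow> nat set set \<Rightarrow> (nat \<Rightarrow> nat) set" where
  "root_auts vG V EH = {\<pi> \<in> V \<rightarrow>\<^sub>E V. inj_on \<pi> V \<and> (\<forall>j\<in>{1..vG}. \<pi> j = j)
      \<and> edge_image (free_edges vG EH) \<pi> = free_edges vG EH}"

lemma free_edges_subset: "EH \<subseteq> all_edges V \<Longrightarrow> free_edges vG EH \<subseteq> all_edges V"
  by (auto simp: free_edges_def)

text \<open>The identity is such a symmetry. Both bounds are independent of n, so passing from
  extensions to embeddings costs only a constant factor.\<close>

lemma card_root_auts:
  assumes "finite V" "{1..vG} \<subseteq> V" "EH \<subseteq> all_edges V"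
  shows "1 \<le> card (root_auts vG V EH)" "card (root_auts vG V EH) \<le> card V ^ card V"
proof -
  have sub: "root_auts vG V EH \<subseteq> V \<rightarrow>\<^sub>E V" by (auto simp: root_auts_def)
  have fin: "finite (V \<rightarrow>\<^sub>E V)" using assms by (simp add: finite_PiE)
  have "restrict (\<lambda>x. x) V ` e = e" if "e \<in> free_edges vG EH" for e
    using free_edges_subset[OF assms(3), of vG] that by (force simp: all_edges_def)
  then have "edge_image (free_edges vG EH) (restrict (\<lambda>x. x) V) = free_edges vG EH"
    by (simp add: edge_image_def)
  then have "restrict (\<lambda>x. x) V \<in> root_auts vG V EH"
    using assms by (auto simp: root_auts_def inj_on_def)
  then have "card (root_auts vG V EH) \<noteq> 0" using finite_subset[OF sub fin] by auto
  then show "1 \<le> card (root_auts vG V EH)" by simp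
  show "card (root_auts vG V EH) \<le> card V ^ card V"
    using card_mono[OF fin sub] assms by (simp add: card_PiE)
qed

lemma edge_image_cong:
  assumes "EE \<subseteq> all_edges V" "\<And>v. v \<in> V \<Longrightarrow> \<phi> v = \<psi> v"
  shows "edge_image EE \<phi> = edge_image EE \<psi>"
  unfolding edge_image_def
proof (rule image_cong[OF refl])
  fix e assume "e \<in> EE"
  then have "e \<subseteq> V" using assms(1) by (auto simp: all_edges_def)
  then show "\<phi> ` e = \<psi> ` e" using assms(2) by (intro image_cong) auto
qed

lemma extensions_eq:
  assumes "{1..vG} \<subseteq> V" "EH \<subseteq> all_edges V"
  shows "extensions vG V EH n x = (\<lambda>\<phi>. (\<phi> ` V, edge_image (free_edges vG EH) \<phi>)) ` emb vG V n x"
proof (intro set_eqI iffI)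
  fix c assume "c \<in> extensions vG V EH n x"
  then obtain \<phi> where c: "c = (\<phi> ` V, edge_image (free_edges vG EH) \<phi>)"
    and \<phi>: "inj_on \<phi> V" "\<phi> ` V \<subseteq> {1..n}" "\<forall>j\<in>{1..vG}. \<phi> j = x j"
    unfolding extensions_def edge_image_def free_edges_def by blast
  have "restrict \<phi> V \<in> emb vG V n x"
    using \<phi> assms(1) by (auto simp: emb_def inj_ext_def inj_on_def)
  moreover have "c = (restrict \<phi> V ` V, edge_image (free_edges vG EH) (restrict \<phi> V))"
    using edge_image_cong[OF free_edges_subset[OF assms(2)], of \<phi> "restrict \<phi> V" vG] c by simp
  ultimately show "c \<in> (\<lambda>\<phi>. (\<phi> ` V, edge_image (free_edges vG EH) \<phi>)) ` emb vG V n x" by blast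
next
  fix c assume "c \<in> (\<lambda>\<phi>. (\<phi> ` V, edge_image (free_edges vG EH) \<phi>)) ` emb vG V n x"
  then obtain \<phi> where c: "c = (\<phi> ` V, edge_image (free_edges vG EH) \<phi>)" and "\<phi> \<in> emb vG V n x"
    by blast
  then have "inj_on \<phi> V" "\<phi> ` V \<subseteq> {1..n}" "\<forall>j\<in>{1..vG}. \<phi> j = x j"
    by (auto simp: emb_def inj_ext_def PiE_def)
  with c show "c \<in> extensions vG V EH n x"
    unfolding extensions_def edge_image_def free_edges_def by blast
qed

text \<open>Composition with \<open>\<phi>\<close> is a bijection from the symmetries onto the
  embeddings with the same image as \<open>\<phi>\<close>; its inverse composes with the inverse of
  \<open>\<phi>\<close>.\<close>

lemma card_same_copy:
  assumes V: "finite V" "{1..vG} \<subseteq> V" "EH \<subseteq> all_edges V" and \<phi>: "\<phi> \<in> emb vG V n x"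
  shows "card {\<psi> \<in> emb vG V n x. (\<psi> ` V, edge_image (free_edges vG EH) \<psi>) = (\<phi> ` V, edge_image (free_edges vG EH) \<phi>)}
    = card (root_auts vG V EH)" (is "card ?F = _")
proof -
  let ?EE = "free_edges vG EH"
  have EE: "?EE \<subseteq> all_edges V" by (rule free_edges_subset[OF V(3)])
  have \<phi>': "inj_on \<phi> V" "\<phi> ` V \<subseteq> {1..n}" "\<And>j. j \<in> {1..vG} \<Longrightarrow> \<phi> j = x j" "\<phi> \<in> extensional V"
    using \<phi> by (auto simp: emb_def inj_ext_def PiE_def)
  have im_comp: "edge_image ?EE (compose V \<phi> \<pi>) = (`) \<phi> ` edge_image ?EE \<pi>" for \<pi>
  proof -
    have "edge_image ?EE (compose V \<phi> \<pi>) = edge_image ?EE (\<phi> \<circ> \<pi>)"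
      by (rule edge_image_cong[OF EE]) (simp add: compose_def)
    then show ?thesis by (simp add: edge_image_def image_image image_comp)
  qed
  have "bij_betw (\<lambda>\<pi>. compose V \<phi> \<pi>) (root_auts vG V EH) ?F"
  proof (rule bij_betw_byWitness[where f' = "\<lambda>\<psi>. restrict (\<lambda>v. inv_into V \<phi> (\<psi> v)) V"])
    show "\<forall>\<pi>\<in>root_auts vG V EH. restrict (\<lambda>v. inv_into V \<phi> (compose V \<phi> \<pi> v)) V = \<pi>"
      using \<phi>'(1) by (auto simp: root_auts_def compose_def fun_eq_iff PiE_def extensional_def Pi_def)
    have inv: "\<phi> (inv_into V \<phi> (\<psi> v)) = \<psi> v" "inv_into V \<phi> (\<psi> v) \<in> V" if "\<psi> \<in> ?F" "v \<in> V" for \<psi> v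
      using that by (auto intro!: f_inv_into_f inv_into_into)
    then show "\<forall>\<psi>\<in>?F. compose V \<phi> (restrict (\<lambda>v. inv_into V \<phi> (\<psi> v)) V) = \<psi>"
      by (auto simp: compose_def fun_eq_iff emb_def inj_ext_def PiE_def extensional_def)
    show "compose V \<phi> ` root_auts vG V EH \<subseteq> ?F"
    proof (rule image_subsetI)
      fix \<pi> assume \<pi>: "\<pi> \<in> root_auts vG V EH"
      then have \<pi>': "\<pi> ` V \<subseteq> V" "inj_on \<pi> V" "\<And>j. j \<in> {1..vG} \<Longrightarrow> \<pi> j = j" "edge_image ?EE \<pi> = ?EE"
        by (auto simp: root_auts_def PiE_def)
      have "\<pi> ` V = V" by (rule endo_inj_surj[OF V(1) \<pi>'(1,2)])
      then have im: "compose V \<phi> \<pi> ` V = \<phi> ` V"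
        unfolding compose_def image_restrict_eq using image_image[of \<phi> \<pi> V] by simp
      have "compose V \<phi> \<pi> \<in> emb vG V n x"
        unfolding emb_def inj_ext_def
      proof (intro CollectI conjI ballI)
        show "compose V \<phi> \<pi> \<in> V \<rightarrow>\<^sub>E {1..n}"
        proof (rule PiE_I)
          fix v assume "v \<in> V"
          then have "compose V \<phi> \<pi> v \<in> \<phi> ` V" using im by blast
          then show "compose V \<phi> \<pi> v \<in> {1..n}" using \<phi>'(2) by blast
        qed (simp add: compose_def)
        show "inj_on (compose V \<phi> \<pi>) V"
          using \<phi>'(1) \<pi>'(2) \<open>\<pi> ` V = V\<close> by (intro inj_on_compose) (auto simp: bij_betw_def)
        show "compose V \<phi> \<pi> j = x j" if "j \<in> {1..vG}" for j
          using that \<pi>'(3) \<phi>'(3) V(2) by (auto simp: compose_def)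
      qed
      moreover have "edge_image ?EE (compose V \<phi> \<pi>) = edge_image ?EE \<phi>"
        unfolding im_comp \<pi>'(4) by (simp add: edge_image_def)
      ultimately show "compose V \<phi> \<pi> \<in> ?F" using im by simp
    qed
    show "(\<lambda>\<psi>. restrict (\<lambda>v. inv_into V \<phi> (\<psi> v)) V) ` ?F \<subseteq> root_auts vG V EH"
    proof (rule image_subsetI)
      fix \<psi> assume \<psi>: "\<psi> \<in> ?F"
      let ?\<pi> = "restrict (\<lambda>v. inv_into V \<phi> (\<psi> v)) V"
      have \<psi>': "inj_on \<psi> V" "\<And>j. j \<in> {1..vG} \<Longrightarrow> \<psi> j = x j" "\<psi> \<in> extensional V"
        using \<psi> by (auto simp: emb_def inj_ext_def PiE_def)
      have "?\<pi> \<in> V \<rightarrow>\<^sub>E V" using inv(2)[OF \<psi>] by auto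
      moreover have "inj_on ?\<pi> V"
      proof (rule inj_onI)
        fix u v assume uv: "u \<in> V" "v \<in> V" "?\<pi> u = ?\<pi> v"
        then have "\<psi> u = \<psi> v" using inv(1)[OF \<psi>] by (metis restrict_apply')
        then show "u = v" using uv \<psi>'(1) by (simp add: inj_on_def)
      qed
      moreover have "?\<pi> j = j" if "j \<in> {1..vG}" for j
      proof -
        have "j \<in> V" using that V(2) by auto
        moreover have "\<psi> j = \<phi> j" using \<psi>'(2) \<phi>'(3) that by simp
        ultimately show ?thesis using \<phi>'(1) by simp
      qed
      moreover have "edge_image ?EE ?\<pi> = ?EE"
      proof -
        have "compose V \<phi> ?\<pi> = \<psi>"
          using inv(1)[OF \<psi>] \<psi>'(3) by (auto simp: compose_def fun_eq_iff extensional_def)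
        then have "(`) \<phi> ` edge_image ?EE ?\<pi> = edge_image ?EE \<psi>" using im_comp[of ?\<pi>] by simp
        also have "\<dots> = (`) \<phi> ` ?EE" using \<psi> by (simp add: edge_image_def)
        finally have eq: "(`) \<phi> ` edge_image ?EE ?\<pi> = (`) \<phi> ` ?EE" .
        have 1: "edge_image ?EE ?\<pi> \<subseteq> Pow V"
          unfolding edge_image_def using EE inv(2)[OF \<psi>] by (auto simp: all_edges_def)
        have 2: "?EE \<subseteq> Pow V" using EE by (auto simp: all_edges_def)
        \<comment> \<open>Taking images under the injective \<open>\<phi>\<close> is itself
          injective on subsets of \<open>V\<close>, so \<open>\<phi>\<close> can be
          cancelled.\<close>
        show ?thesis using inj_on_image_eq_iff[OF inj_on_image_Pow[OF \<phi>'(1)] 1 2] eq by simp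
      qed
      ultimately show "?\<pi> \<in> root_auts vG V EH" by (simp add: root_auts_def)
    qed
  qed
  then show ?thesis by (simp add: bij_betw_same_card)
qed

lemma card_emb_subset_eq:
  assumes V: "finite V" "{1..vG} \<subseteq> V" "EH \<subseteq> all_edges V"
  shows "card {\<phi> \<in> emb vG V n x. edge_image (free_edges vG EH) \<phi> \<subseteq> E}
    = card (root_auts vG V EH) * ext_count vG V EH n x E"
proof -
  let ?f = "\<lambda>\<phi>. (\<phi> ` V, edge_image (free_edges vG EH) \<phi>)"
  let ?A = "{\<phi> \<in> emb vG V n x. edge_image (free_edges vG EH) \<phi> \<subseteq> E}"
  have fin: "finite ?A" using finite_emb[OF V(1)] by simp
  have im: "?f ` ?A = {c \<in> extensions vG V EH n x. snd c \<subseteq> E}"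
    unfolding extensions_eq[OF V(2,3)] by auto
  have "card ?A = (\<Sum>c\<in>?f ` ?A. card {\<phi> \<in> ?A. ?f \<phi> = c})"
    using sum.image_gen[OF fin, of "\<lambda>_. 1::nat" ?f] by simp
  also have "\<dots> = (\<Sum>c\<in>?f ` ?A. card (root_auts vG V EH))"
  proof (rule sum.cong[OF refl])
    fix c assume "c \<in> ?f ` ?A"
    then obtain \<phi> where \<phi>: "\<phi> \<in> ?A" "c = ?f \<phi>" by blast
    then have "{\<psi> \<in> ?A. ?f \<psi> = c} = {\<psi> \<in> emb vG V n x. ?f \<psi> = ?f \<phi>}" by auto
    then show "card {\<psi> \<in> ?A. ?f \<psi> = c} = card (root_auts vG V EH)"
      using card_same_copy[OF V] \<phi> by simp
  qed
  finally show ?thesis unfolding im ext_count_def by simp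
qed

subsection \<open>Overlaps of embeddings\<close>

text \<open>The bridge from graphs to \<open>copies\<close>: every extension comes from the same
  number of embeddings, and every embedding has the same number of edges, so the centring of
  \<open>W\<close> adds up to a single constant.\<close>

lemma ext_count_eq_W:
  fixes p :: real
  assumes V: "finite V" "{1..vG} \<subseteq> V" "EH \<subseteq> all_edges V" and p: "0 \<le> p" "p \<le> 1"
  shows "card (root_auts vG V EH) * real (ext_count vG V EH n x {e \<in> all_edges {1..n}. f e})
    = copies.W p (emb vG V n x) (edge_image (free_edges vG EH)) f
      + card (emb vG V n x) * p ^ card (free_edges vG EH)"
proof -
  let ?EE = "free_edges vG EH" and ?A = "emb vG V n x"
  have EE: "?EE \<subseteq> all_edges V" by (rule free_edges_subset[OF V(3)])
  interpret copies "all_edges {1..n}" p ?A "edge_image ?EE"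
    by (rule copies_emb[OF V(1) EE p])
  have "W f = (\<Sum>\<phi>\<in>?A. of_bool (edge_image ?EE \<phi> \<subseteq> {e \<in> all_edges {1..n}. f e}) - p ^ card ?EE)"
    unfolding W_def Y_def
  proof (rule sum.cong[OF refl])
    fix \<phi> assume \<phi>: "\<phi> \<in> ?A"
    have "(\<forall>e\<in>edge_image ?EE \<phi>. f e) \<longleftrightarrow> edge_image ?EE \<phi> \<subseteq> {e \<in> all_edges {1..n}. f e}"
      using edge_image_subset[OF \<phi> EE] by blast
    then show "all_on (edge_image ?EE \<phi>) f - p ^ card (edge_image ?EE \<phi>)
        = of_bool (edge_image ?EE \<phi> \<subseteq> {e \<in> all_edges {1..n}. f e}) - p ^ card ?EE"
      by (simp add: all_on_def card_edge_image[OF \<phi> EE])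
  qed
  also have "\<dots> = card {\<phi> \<in> ?A. edge_image ?EE \<phi> \<subseteq> {e \<in> all_edges {1..n}. f e}} - card ?A * p ^ card ?EE"
    by (simp add: sum_subtractf finite_emb[OF V(1)] Int_def del: Collect_mem_eq)
  finally show ?thesis using card_emb_subset_eq[OF V] by simp
qed

lemma expec_W_eq_0:
  assumes "copies U p A S"
  shows "measure_pmf.expectation (Pi_pmf U False (\<lambda>_. bernoulli_pmf p)) (copies.W p A S) = 0"
proof -
  interpret copies U p A S by fact
  show ?thesis by (simp add: W_def[abs_def] expec_Y)
qed

lemma mu_eq:
  fixes p :: real
  assumes V: "finite V" "{1..vG} \<subseteq> V" "EH \<subseteq> all_edges V" and p: "0 \<le> p" "p \<le> 1"
  shows "card (root_auts vG V EH) * mu vG V EH n p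
    = card (emb vG V n (\<lambda>j. j)) * p ^ card (free_edges vG EH)"
proof -
  let ?EE = "free_edges vG EH" and ?A = "emb vG V n (\<lambda>j. j)"
  have C: "copies (all_edges {1..n}) p ?A (edge_image ?EE)"
    by (rule copies_emb[OF V(1) free_edges_subset[OF V(3)] p])
  then interpret copies "all_edges {1..n}" p ?A "edge_image ?EE" .
  have "card (root_auts vG V EH) * mu vG V EH n p
     = expec (\<lambda>f. card (root_auts vG V EH) * real (ext_count vG V EH n (\<lambda>j. j) {e \<in> all_edges {1..n}. f e}))"
    by (simp add: mu_def Gnp_def)
  also have "\<dots> = expec (\<lambda>f. W f + card ?A * p ^ card ?EE)"
    by (simp only: ext_count_eq_W[OF V p])
  also have "\<dots> = expec W + expec (\<lambda>_. card ?A * p ^ card ?EE)"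
    by (rule Bochner_Integration.integral_add) (rule integrable_Om)+
  also have "\<dots> = card ?A * p ^ card ?EE"
    unfolding expec_W_eq_0[OF C] by simp
  finally show ?thesis .
qed

text \<open>This is why \<open>mu\<close>, computed at one tuple, is the mean at every
  tuple.\<close>

lemma card_emb_eq:
  assumes "finite V" "{1..vG} \<subseteq> V" "vG \<le> n" "x \<in> tuples n vG"
  shows "card (emb vG V n x) = card (emb vG V n (\<lambda>j. j))"
proof -
  have "inj_on x {1..vG}" "x ` {1..vG} \<subseteq> {1..n}" using assms(4) by (auto simp: tuples_def)
  then show ?thesis unfolding emb_def
    using assms by (simp add: card_inj_ext)
qed

lemma card_emb_bounds:
  assumes "finite V" "{1..vG} \<subseteq> V" "x \<in> tuples n vG"
  shows "card (emb vG V n x) \<le> n ^ (card V - vG)"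
    "2 * card V \<le> n \<Longrightarrow> (real n / 2) ^ (card V - vG) \<le> card (emb vG V n x)"
proof -
  have x: "inj_on x {1..vG}" "x ` {1..vG} \<subseteq> {1..n}" using assms(3) by (auto simp: tuples_def)
  have "card (V - {1..vG}) = card V - vG" using assms by (simp add: card_Diff_subset)
  then show "card (emb vG V n x) \<le> n ^ (card V - vG)"
    "2 * card V \<le> n \<Longrightarrow> (real n / 2) ^ (card V - vG) \<le> card (emb vG V n x)"
    unfolding emb_def
    using card_inj_ext_le[OF assms(1,2) _ x] card_inj_ext_ge[OF assms(1,2) _ x] by simp_all
qed

lemma id_tuple: "vG \<le> n \<Longrightarrow> restrict (\<lambda>j. j) {1..vG} \<in> tuples n vG"
  by (auto simp: tuples_def inj_on_def)

section \<open>Rooted graphs and the subgraphs competing in \<open>Phi\<close>\<close>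

locale rooted =
  fixes vG :: nat and VH :: "nat set" and EH :: "nat set set"
  assumes rooted: "rooted_graph vG VH EH"
begin

abbreviation "EE \<equiv> free_edges vG EH"
abbreviation "vH \<equiv> card VH"

lemma VH: "finite VH" "{1..vG} \<subseteq> VH" "EH \<subseteq> all_edges VH"
  and card_EH: "card (root_edges vG EH) < card EH"
  using rooted by (auto simp: rooted_graph_def)

lemma EE_subset: "EE \<subseteq> all_edges VH" by (rule free_edges_subset[OF VH(3)])

lemma finite_EH: "finite EH" using VH finite_all_edges finite_subset by blast

lemma finite_EE: "finite EE" using finite_EH by (simp add: free_edges_def)

lemma vG_le: "vG \<le> vH" using card_mono[OF VH(1,2)] by simp

lemma vH_pos: "0 < vH"
proof -
  have "EH \<noteq> {}" using card_EH by auto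
  then obtain e where "e \<in> EH" by blast
  then have "e \<subseteq> VH" "card e = 2" using VH(3) by (auto simp: all_edges_def)
  then have "VH \<noteq> {}" by auto
  then show ?thesis using VH(1) by (simp add: card_gt_0_iff)
qed

text \<open>The graphs \<open>J\<close> in the definition of \<open>\<Phi>\<close>, encoded by their vertices and their edges outside \<open>G\<close>.\<close>
definition sub :: "nat set \<Rightarrow> nat set set \<Rightarrow> bool" where
  "sub V F \<longleftrightarrow> {1..vG} \<subseteq> V \<and> V \<subseteq> VH \<and> F \<subseteq> EE \<and> F \<subseteq> all_edges V \<and> F \<noteq> {}"

text \<open>Splitting off the root edges turns the condition that J has more edges than G into
  \<open>F \<noteq> {}\<close>.\<close>

lemma Phi_eq:
  "Phi vG VH EH n p = Min {mu vG V (root_edges vG EH \<union> F) n p | V F. sub V F}" (is "_ = Min ?R")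
proof -
  let ?L = "{mu vG VJ EJ n p | VJ EJ.
      {1..vG} \<subseteq> VJ \<and> VJ \<subseteq> VH \<and> EJ \<subseteq> EH \<and> EJ \<subseteq> all_edges VJ
      \<and> root_edges vG EH \<subseteq> EJ \<and> card EJ > card (root_edges vG EH)}"
  have "?L = ?R"
  proof (intro set_eqI iffI)
    fix y assume "y \<in> ?L"
    then obtain VJ EJ where y: "y = mu vG VJ EJ n p" "{1..vG} \<subseteq> VJ" "VJ \<subseteq> VH" "EJ \<subseteq> EH"
      "EJ \<subseteq> all_edges VJ" "root_edges vG EH \<subseteq> EJ" "card EJ > card (root_edges vG EH)" by blast
    let ?F = "EJ - root_edges vG EH"
    have "?F \<noteq> {}"
    proof
      assume "?F = {}"
      then have "EJ \<subseteq> root_edges vG EH" by blast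
      moreover have "finite (root_edges vG EH)" using finite_EH by (simp add: root_edges_def)
      ultimately show False using y(7) card_mono leD by blast
    qed
    then have "sub VJ ?F" using y by (auto simp: sub_def free_edges_def)
    moreover have "root_edges vG EH \<union> ?F = EJ" using y by blast
    then have "y = mu vG VJ (root_edges vG EH \<union> ?F) n p" by (simp only: y(1))
    ultimately show "y \<in> ?R" by blast
  next
    fix y assume "y \<in> ?R"
    then obtain V F where y: "y = mu vG V (root_edges vG EH \<union> F) n p" and s: "sub V F" by blast
    have re: "root_edges vG EH \<subseteq> all_edges V" "root_edges vG EH \<subseteq> EH"
      using s VH(3) by (auto simp: sub_def root_edges_def all_edges_def)
    have "root_edges vG EH \<inter> F = {}" "finite F" using s finite_subset[OF _ finite_EE] by (auto simp: sub_def free_edges_def)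
    then have "card (root_edges vG EH \<union> F) = card (root_edges vG EH) + card F"
      using finite_subset[OF re(2) finite_EH] by (intro card_Un_disjoint)
    moreover have "card F > 0" using s \<open>finite F\<close> by (simp add: sub_def card_gt_0_iff)
    ultimately have "card (root_edges vG EH) < card (root_edges vG EH \<union> F)" by simp
    moreover have "{1..vG} \<subseteq> V" "V \<subseteq> VH" "root_edges vG EH \<union> F \<subseteq> EH"
      "root_edges vG EH \<union> F \<subseteq> all_edges V" "root_edges vG EH \<subseteq> root_edges vG EH \<union> F"
      using s re by (auto simp: sub_def free_edges_def)
    ultimately show "y \<in> ?L" using y by blast
  qed
  then show ?thesis by (simp add: Phi_def)
qed

lemma sub_facts:
  assumes "sub V F"
  shows "finite V" "{1..vG} \<subseteq> V" "root_edges vG EH \<union> F \<subseteq> all_edges V"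
    "free_edges vG (root_edges vG EH \<union> F) = F" "card V \<le> vH" "finite F" "vG \<le> card V" "F \<subseteq> EE" "V \<subseteq> VH"
proof -
  show fin: "finite V" and 2: "{1..vG} \<subseteq> V" and "F \<subseteq> EE" "V \<subseteq> VH"
    using assms finite_subset[OF _ VH(1)] by (auto simp: sub_def)
  show "root_edges vG EH \<union> F \<subseteq> all_edges V" "free_edges vG (root_edges vG EH \<union> F) = F"
    using assms VH(3) by (auto simp: sub_def root_edges_def all_edges_def free_edges_def)
  show "card V \<le> vH" using assms VH(1) by (simp add: sub_def card_mono)
  show "finite F" using assms finite_subset[OF _ finite_EE] by (auto simp: sub_def)
  show "vG \<le> card V" using card_mono[OF fin 2] by simp
qed

lemma finite_Phi_set: "finite {mu vG V (root_edges vG EH \<union> F) n p | V F. sub V F}"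
proof -
  have "{mu vG V (root_edges vG EH \<union> F) n p | V F. sub V F}
     \<subseteq> (\<lambda>(V, F). mu vG V (root_edges vG EH \<union> F) n p) ` (Pow VH \<times> Pow EE)"
    by (auto simp: sub_def)
  then show ?thesis by (rule finite_subset) (use VH(1) finite_EE in simp)
qed

lemma EE_nonempty: "EE \<noteq> {}"
proof
  assume "EE = {}"
  then have "EH = root_edges vG EH" by (auto simp: free_edges_def root_edges_def)
  then show False using card_EH by simp
qed

text \<open>The factors count, in this order, the possible sets of shared edges, the placements of
  vertices among at most \<open>m * vH\<close> vertices already in use, and the loss in the lower
  bound \<open>M_ge\<close>.\<close>

definition overlap_const :: "nat \<Rightarrow> real" where
  "overlap_const m = 2 ^ card EE * (real (m * vH) + 1) ^ vH * 2 ^ vH"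

lemma sub_H: "sub VH EE"
  using VH EE_subset EE_nonempty by (simp add: sub_def)

lemma emb_id: "emb vG V n (restrict (\<lambda>j. j) {1..vG}) = emb vG V n (\<lambda>j. j)"
  by (simp add: emb_def inj_ext_def)

context
  fixes n :: nat and p :: real
  assumes p: "0 \<le> p" "p \<le> 1" and n: "2 * vH \<le> n"
begin

lemma mu_sub_eq:
  assumes "sub V F"
  shows "card (root_auts vG V (root_edges vG EH \<union> F)) * mu vG V (root_edges vG EH \<union> F) n p
     = card (emb vG V n (\<lambda>j. j)) * p ^ card F"
  using mu_eq[OF sub_facts(1-3)[OF assms] p, of n] sub_facts(4)[OF assms] by simp

text \<open>Any J bounds the minimum from above; its symmetry factor, being at least 1, is inserted
  to pass from \<open>mu\<close> to a count of embeddings.\<close>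

lemma Phi_le:
  assumes "sub V F"
  shows "Phi vG VH EH n p \<le> real n ^ (card V - vG) * p ^ card F"
proof -
  let ?E = "root_edges vG EH \<union> F"
  have "Phi vG VH EH n p \<le> mu vG V ?E n p"
    unfolding Phi_eq using assms by (intro Min_le finite_Phi_set) blast
  also have "\<dots> \<le> card (root_auts vG V ?E) * mu vG V ?E n p"
  proof -
    have "1 \<le> real (card (root_auts vG V ?E))"
      using card_root_auts(1)[OF sub_facts(1-3)[OF assms]] by simp
    moreover have "0 \<le> mu vG V ?E n p" unfolding mu_def by (simp add: integral_nonneg_AE)
    ultimately show ?thesis by (simp add: mult_le_cancel_right1)
  qed
  also have "\<dots> = card (emb vG V n (\<lambda>j. j)) * p ^ card F" by (rule mu_sub_eq[OF assms])
  also have "\<dots> \<le> real n ^ (card V - vG) * p ^ card F"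
  proof (intro mult_right_mono)
    have "card (emb vG V n (\<lambda>j. j)) \<le> n ^ (card V - vG)"
      using card_emb_bounds(1)[OF sub_facts(1,2)[OF assms] id_tuple, of n, unfolded emb_id] vG_le n by simp
    then show "real (card (emb vG V n (\<lambda>j. j))) \<le> real n ^ (card V - vG)"
      by (metis of_nat_le_iff of_nat_power)
  qed (use p in auto)
  finally show ?thesis .
qed

text \<open>A J attaining the minimum has at most \<open>vH ^ vH\<close> symmetries and at least a
  constant fraction of the largest conceivable number of embeddings.\<close>

lemma Phi_ge:
  "\<exists>V F. sub V F \<and> (real n / 2) ^ (card V - vG) * p ^ card F \<le> Phi vG VH EH n p * vH ^ vH"
proof -
  let ?S = "{mu vG V (root_edges vG EH \<union> F) n p | V F. sub V F}"
  have "?S \<noteq> {}" using sub_H by blast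
  from Min_in[OF finite_Phi_set this] obtain V F where s: "sub V F"
    and eq: "Phi vG VH EH n p = mu vG V (root_edges vG EH \<union> F) n p"
    unfolding Phi_eq by blast
  let ?E = "root_edges vG EH \<union> F"
  have "(real n / 2) ^ (card V - vG) * p ^ card F \<le> card (emb vG V n (\<lambda>j. j)) * p ^ card F"
    using card_emb_bounds(2)[OF sub_facts(1,2)[OF s] id_tuple, of n, unfolded emb_id] vG_le n p sub_facts(5)[OF s]
    by (intro mult_right_mono) auto
  also have "\<dots> = card (root_auts vG V ?E) * mu vG V ?E n p" by (rule mu_sub_eq[OF s, symmetric])
  also have "\<dots> \<le> vH ^ vH * mu vG V ?E n p"
  proof (intro mult_right_mono)
    have "card (root_auts vG V ?E) \<le> card V ^ card V" by (rule card_root_auts(2)[OF sub_facts(1-3)[OF s]])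
    also have "\<dots> \<le> vH ^ card V" using sub_facts(5)[OF s] by (rule power_mono) simp
    also have "\<dots> \<le> vH ^ vH" using sub_facts(5)[OF s] vH_pos by (intro power_increasing) auto
    finally show "real (card (root_auts vG V ?E)) \<le> real (vH ^ vH)" by simp
    show "0 \<le> mu vG V ?E n p" unfolding mu_def by (simp add: integral_nonneg_AE)
  qed
  finally show ?thesis using s eq by (auto simp: mult.commute)
qed

context
  fixes x assumes x: "x \<in> tuples n vG" and Phi_pos: "0 < Phi vG VH EH n p"
begin

interpretation copies "all_edges {1..n}" p "emb vG VH n x" "edge_image EE"
  by (rule copies_emb[OF VH(1) EE_subset p])

lemma M_eq: "M = card (emb vG VH n x) * p ^ card EE"
  unfolding M_def by (simp add: card_edge_image[OF _ EE_subset])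

lemma M_ge: "real n ^ (vH - vG) * p ^ card EE \<le> 2 ^ vH * M"
proof -
  have "real n ^ (vH - vG) = 2 ^ (vH - vG) * (real n / 2) ^ (vH - vG)"
    by (simp flip: power_mult_distrib)
  also have "\<dots> \<le> 2 ^ vH * real (card (emb vG VH n x))"
    using card_emb_bounds(2)[OF VH(1,2) x n] by (intro mult_mono power_increasing) auto
  finally have "real n ^ (vH - vG) \<le> 2 ^ vH * real (card (emb vG VH n x))" .
  from mult_right_mono[OF this, of "p ^ card EE"] show ?thesis
    using p by (simp add: M_eq mult.assoc)
qed

text \<open>Positivity of \<open>Phi\<close> passes to J = H through \<open>Phi_le\<close>.\<close>

lemma M_pos: "0 < M"
proof -
  have "0 < real n ^ (vH - vG) * p ^ card EE"
    using Phi_le[OF sub_H] Phi_pos by linarith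
  also note M_ge
  finally show ?thesis by (simp add: zero_less_mult_iff)
qed

text \<open>Count vertex by vertex: roots are fixed, other endpoints of \<open>F\<close> must lie in
  \<open>P\<close>, and the rest are free. The factor \<open>q + 1\<close> covers the choices inside
  \<open>P\<close> and is at least 1, so it can be charged at every vertex.\<close>

lemma card_meeting_le:
  assumes P: "finite P" "card P \<le> q" and F: "F \<subseteq> EE"
  shows "real (card {a \<in> emb vG VH n x. \<forall>f\<in>F. a ` f \<subseteq> P})
     \<le> (real q + 1) ^ vH * real n ^ card (VH - ({1..vG} \<union> \<Union>F))"
proof -
  let ?B = "\<lambda>v. if v \<in> {1..vG} then {x v} else if v \<in> \<Union>F then P else {1..n}"
  have "{a \<in> emb vG VH n x. \<forall>f\<in>F. a ` f \<subseteq> P} \<subseteq> PiE VH ?B"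
  proof
    fix a assume a: "a \<in> {a \<in> emb vG VH n x. \<forall>f\<in>F. a ` f \<subseteq> P}"
    show "a \<in> PiE VH ?B"
    proof (rule PiE_I)
      fix v assume "v \<in> VH"
      moreover have "a v = x v" if "v \<in> {1..vG}" using that a by (simp add: emb_def inj_ext_def)
      moreover have "a v \<in> P" if "v \<in> \<Union>F" using that a by blast
      moreover have "a v \<in> {1..n}" using a \<open>v \<in> VH\<close> by (auto simp: emb_def inj_ext_def dest: PiE_mem)
      ultimately show "a v \<in> ?B v" by (simp only: singleton_iff split: if_split) blast
    next
      fix v assume "v \<notin> VH"
      then show "a v = undefined" using a by (auto simp: emb_def inj_ext_def)
    qed
  qed
  moreover have "finite (PiE VH ?B)" using VH(1) P by (intro finite_PiE) auto
  ultimately have "card {a \<in> emb vG VH n x. \<forall>f\<in>F. a ` f \<subseteq> P} \<le> card (PiE VH ?B)"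
    by (intro card_mono)
  then have "real (card {a \<in> emb vG VH n x. \<forall>f\<in>F. a ` f \<subseteq> P}) \<le> (\<Prod>v\<in>VH. real (card (?B v)))"
    using VH(1) by (simp add: card_PiE flip: of_nat_prod)
  also have "\<dots> \<le> (\<Prod>v\<in>VH. (real q + 1) * (if v \<in> {1..vG} \<union> \<Union>F then 1 else real n))"
    using P by (intro prod_mono) (auto simp: algebra_simps)
  also have "\<dots> = (real q + 1) ^ vH * real n ^ card (VH - ({1..vG} \<union> \<Union>F))"
  proof -
    have "(\<Prod>v\<in>VH. (real q + 1) * (if v \<in> X then 1 else real n)) = (real q + 1) ^ vH * real n ^ card (VH - X)" for X
      using VH(1) by (simp add: prod.distrib prod.If_cases Diff_eq)
    then show ?thesis .
  qed
  finally show ?thesis .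
qed

text \<open>Group the overlapping embeddings by the set \<open>F\<close> of free edges sent to used
  edges. With the roots and endpoints of \<open>F\<close> as vertices this is a J, and
  \<open>Phi_le\<close> says that fixing those vertices and saving those edges reduces the total
  weight by a factor of order \<open>Phi\<close>.\<close>

lemma overlap_upper:
  assumes L: "set L \<subseteq> emb vG VH n x" "length L < m"
  shows "(\<Sum>a | a \<in> emb vG VH n x \<and> touch a (set L). p ^ card (edge_image EE a - \<Union>(edge_image EE ` set L)))
    \<le> overlap_const m / Phi vG VH EH n p * M"
proof -
  let ?\<Phi> = "Phi vG VH EH n p" and ?q = "m * vH" and ?A = "emb vG VH n x"
  let ?V = "\<Union>(edge_image EE ` set L)"
  \<comment> \<open>Every endpoint of an edge already in use lies in this set, whose size does not
    depend on n.\<close>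
  define P where "P = (\<Union>l\<in>set L. l ` VH)"
  have finP: "finite P" using VH(1) by (simp add: P_def)
  have "card P \<le> (\<Sum>l\<in>set L. card (l ` VH))" unfolding P_def by (intro card_UN_le) simp
  also have "\<dots> \<le> (\<Sum>l\<in>set L. vH)" by (intro sum_mono card_image_le VH(1))
  also have "\<dots> \<le> ?q" using card_length[of L] L(2) by simp
  finally have cardP: "card P \<le> ?q" .
  define T where "T a = {f \<in> EE. a ` f \<in> ?V}" for a :: "nat \<Rightarrow> nat"
  let ?X = "{a \<in> ?A. touch a (set L)}"
  have finX: "finite ?X" using finite_emb[OF VH(1)] by simp
  have TX: "T ` ?X \<subseteq> Pow EE - {{}}"
    by (auto simp: T_def touch_def edge_image_def)
  have V_P: "g \<subseteq> P" if "g \<in> ?V" for g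
    using that EE_subset by (fastforce simp: edge_image_def P_def all_edges_def)
  have card_diff: "card (edge_image EE a - ?V) = card EE - card (T a)" if "a \<in> ?A" for a
  proof -
    have inj: "inj_on ((`) a) EE"
      using that EE_subset by (intro inj_on_image_edges) (auto simp: emb_def inj_ext_def)
    have "edge_image EE a - ?V = (`) a ` (EE - T a)" by (auto simp: edge_image_def T_def)
    then have "card (edge_image EE a - ?V) = card (EE - T a)"
      using inj by (simp add: card_image inj_on_diff)
    also have "\<dots> = card EE - card (T a)"
      using finite_EE by (intro card_Diff_subset) (auto simp: T_def)
    finally show ?thesis .
  qed
  have "(\<Sum>a\<in>?X. p ^ card (edge_image EE a - ?V))
     = (\<Sum>F\<in>Pow EE - {{}}. \<Sum>a | a \<in> ?X \<and> T a = F. p ^ card (edge_image EE a - ?V))"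
    by (rule sum.group[symmetric]) (use finX finite_EE TX in auto)
  also have "\<dots> \<le> (\<Sum>F\<in>Pow EE - {{}}. (real ?q + 1) ^ vH * 2 ^ vH * M / ?\<Phi>)"
  proof (rule sum_mono)
    fix F assume "F \<in> Pow EE - {{}}"
    then have F: "F \<subseteq> EE" "F \<noteq> {}" "finite F" using finite_subset[OF _ finite_EE] by auto
    let ?V' = "{1..vG} \<union> \<Union>F"
    have V': "?V' \<subseteq> VH" using F EE_subset VH(2) by (auto simp: all_edges_def)
    have s: "sub ?V' F" using F V' EE_subset by (auto simp: sub_def all_edges_def)
    note sf = sub_facts[OF s]
    have "(\<Sum>a | a \<in> ?X \<and> T a = F. p ^ card (edge_image EE a - ?V))
       = (\<Sum>a | a \<in> ?X \<and> T a = F. p ^ (card EE - card F))"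
      by (intro sum.cong refl) (auto simp: card_diff)
    also have "\<dots> = real (card {a. a \<in> ?X \<and> T a = F}) * p ^ (card EE - card F)" by simp
    also have "\<dots> \<le> real (card {a \<in> ?A. \<forall>f\<in>F. a ` f \<subseteq> P}) * p ^ (card EE - card F)"
    proof (intro mult_right_mono of_nat_mono card_mono)
      show "{a. a \<in> ?X \<and> T a = F} \<subseteq> {a \<in> ?A. \<forall>f\<in>F. a ` f \<subseteq> P}"
        using V_P by (auto simp: T_def)
    qed (use p finite_emb[OF VH(1)] in auto)
    also have "\<dots> \<le> (real ?q + 1) ^ vH * real n ^ card (VH - ?V') * p ^ (card EE - card F)"
      using p by (intro mult_right_mono card_meeting_le finP cardP F) auto
    finally have 1: "(\<Sum>a | a \<in> ?X \<and> T a = F. p ^ card (edge_image EE a - ?V))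
       \<le> (real ?q + 1) ^ vH * real n ^ card (VH - ?V') * p ^ (card EE - card F)" .
    have "real n ^ card (VH - ?V') * p ^ (card EE - card F) * ?\<Phi>
       \<le> real n ^ card (VH - ?V') * p ^ (card EE - card F) * (real n ^ (card ?V' - vG) * p ^ card F)"
      using Phi_le[OF s] p by (intro mult_left_mono) auto
    also have "\<dots> = real n ^ (card (VH - ?V') + (card ?V' - vG)) * p ^ (card EE - card F + card F)"
      by (simp only: power_add mult_ac)
    also have "card (VH - ?V') + (card ?V' - vG) = vH - vG"
      using card_Diff_subset[OF sf(1) V'] sf(5,7) by linarith
    also have "card EE - card F + card F = card EE" using card_mono[OF finite_EE F(1)] by simp
    also have "real n ^ (vH - vG) * p ^ card EE \<le> 2 ^ vH * M" by (rule M_ge)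
    finally have "real n ^ card (VH - ?V') * p ^ (card EE - card F) \<le> 2 ^ vH * M / ?\<Phi>"
      using Phi_pos by (simp add: pos_le_divide_eq)
    then have "(real ?q + 1) ^ vH * (real n ^ card (VH - ?V') * p ^ (card EE - card F))
        \<le> (real ?q + 1) ^ vH * (2 ^ vH * M / ?\<Phi>)"
      by (intro mult_left_mono) auto
    with 1 show "(\<Sum>a | a \<in> ?X \<and> T a = F. p ^ card (edge_image EE a - ?V))
       \<le> (real ?q + 1) ^ vH * 2 ^ vH * M / ?\<Phi>" by (simp add: mult.assoc)
  qed
  also have "\<dots> \<le> (\<Sum>F\<in>Pow EE. (real ?q + 1) ^ vH * 2 ^ vH * M / ?\<Phi>)"
    using finite_EE Phi_pos M_pos by (intro sum_mono2) auto
  also have "\<dots> = overlap_const m / ?\<Phi> * M" using finite_EE by (simp add: overlap_const_def card_Pow)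
  finally show ?thesis .
qed

text \<open>Let J attain the minimum in \<open>Phi\<close>. For each \<open>a\<close>, the
  embeddings \<open>b\<close> that agree with \<open>a\<close> on the vertices of J share the images
  of its free edges, and there are enough of them to give weight of order \<open>M\<close> divided
  by \<open>Phi\<close>.\<close>

lemma overlap_lower:
  "M\<^sup>2 / (Phi vG VH EH n p * vH ^ vH * 2 ^ vH)
    \<le> (\<Sum>a\<in>emb vG VH n x. \<Sum>b\<in>nb a. p ^ card (edge_image EE a \<union> edge_image EE b))"
proof -
  let ?\<Phi> = "Phi vG VH EH n p" and ?A = "emb vG VH n x"
  let ?C = "real vH ^ vH * 2 ^ vH"
  obtain V F where s: "sub V F" and ge: "(real n / 2) ^ (card V - vG) * p ^ card F \<le> ?\<Phi> * vH ^ vH"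
    using Phi_ge by blast
  note sf = sub_facts[OF s]
  have eF: "card F \<le> card EE" using card_mono[OF finite_EE sf(8)] .
  \<comment> \<open>A lower bound for the weight of the choices of \<open>b\<close>: the vertices
    outside J are placed freely, and only the edges outside \<open>F\<close> are paid for.\<close>
  define r where "r = (real n / 2) ^ (vH - card V) * p ^ (card EE - card F)"
  have r0: "0 \<le> r" using p by (simp add: r_def)
  have "M \<le> real n ^ (vH - vG) * p ^ card EE"
    unfolding M_eq using card_emb_bounds(1)[OF VH(1,2) x] p
    by (intro mult_right_mono) (metis of_nat_le_iff of_nat_power, simp)
  also have "\<dots> \<le> 2 ^ vH * ((real n / 2) ^ (vH - vG) * p ^ card EE)"
  proof -
    have "real n ^ (vH - vG) = 2 ^ (vH - vG) * (real n / 2) ^ (vH - vG)"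
      by (simp flip: power_mult_distrib)
    also have "\<dots> \<le> 2 ^ vH * (real n / 2) ^ (vH - vG)"
      by (intro mult_right_mono power_increasing) auto
    finally have "real n ^ (vH - vG) \<le> 2 ^ vH * (real n / 2) ^ (vH - vG)" .
    from mult_right_mono[OF this, of "p ^ card EE"] show ?thesis
      using p by (simp add: mult.assoc)
  qed
  also have "(real n / 2) ^ (vH - vG) * p ^ card EE = r * ((real n / 2) ^ (card V - vG) * p ^ card F)"
  proof -
    have "vH - vG = (vH - card V) + (card V - vG)" using sf(5,7) by linarith
    moreover have "card EE = (card EE - card F) + card F" using eF by simp
    ultimately have "(real n / 2) ^ (vH - vG) * p ^ card EE
       = (real n / 2) ^ ((vH - card V) + (card V - vG)) * p ^ ((card EE - card F) + card F)" by simp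
    then show ?thesis unfolding r_def by (simp only: power_add mult_ac)
  qed
  also have "2 ^ vH * (r * ((real n / 2) ^ (card V - vG) * p ^ card F)) \<le> 2 ^ vH * (r * (?\<Phi> * vH ^ vH))"
    using ge r0 by (intro mult_left_mono) auto
  finally have "M \<le> r * (?\<Phi> * vH ^ vH * 2 ^ vH)" by (simp add: mult_ac)
  then have Mr: "M / (?\<Phi> * vH ^ vH * 2 ^ vH) \<le> r"
    using Phi_pos vH_pos by (subst pos_divide_le_eq) auto
  have inner: "p ^ card EE * r \<le> (\<Sum>b\<in>nb a. p ^ card (edge_image EE a \<union> edge_image EE b))" if a: "a \<in> ?A" for a
  proof -
    have aV: "inj_on a VH" "a ` VH \<subseteq> {1..n}" "\<And>j. j \<in> {1..vG} \<Longrightarrow> a j = x j"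
      using a by (auto simp: emb_def inj_ext_def)
    let ?B = "inj_ext V VH {1..n} a"
    have same: "b ` f = a ` f" if "b \<in> ?B" "f \<in> F" for b f
    proof (rule image_cong[OF refl])
      fix v assume "v \<in> f"
      then have "v \<in> V" using that(2) s by (auto simp: sub_def all_edges_def)
      then show "b v = a v" using that(1) by (simp add: inj_ext_def)
    qed
    have share: "edge_image F a \<subseteq> edge_image EE a \<inter> edge_image EE b" if "b \<in> ?B" for b
    proof
      fix g assume "g \<in> edge_image F a"
      then obtain f where "f \<in> F" "g = a ` f" by (auto simp: edge_image_def)
      then show "g \<in> edge_image EE a \<inter> edge_image EE b"
        using same[OF that] sf(8) unfolding edge_image_def by blast
    qed
    have B_A: "?B \<subseteq> ?A" using aV sf(2) by (auto simp: inj_ext_def emb_def)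
    have F_ne: "edge_image F a \<noteq> {}" using s by (simp add: edge_image_def sub_def)
    have B: "?B \<subseteq> nb a" using B_A share F_ne by (fastforce simp: nb_def)
    have le: "card (edge_image EE a \<union> edge_image EE b) \<le> card EE + (card EE - card F)" if b: "b \<in> ?B" for b
    proof -
      have fin: "finite (edge_image EE a)" "finite (edge_image EE b)" using finite_EE by (simp_all add: edge_image_def)
      have "card F = card (edge_image F a)"
        using card_edge_image[OF a, of F] sf(8) EE_subset by simp
      also have "\<dots> \<le> card (edge_image EE a \<inter> edge_image EE b)"
        using share[OF b] fin by (intro card_mono) auto
      finally show ?thesis
        using card_Un_Int[OF fin] card_edge_image[OF a EE_subset] card_edge_image[OF subsetD[OF B_A b] EE_subset] eF
        by linarith
    qed
    have "p ^ card EE * r = (real n / 2) ^ (vH - card V) * p ^ (card EE + (card EE - card F))"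
      by (simp add: r_def power_add)
    also have "\<dots> \<le> card ?B * p ^ (card EE + (card EE - card F))"
    proof -
      have "(real n / 2) ^ card (VH - V) \<le> card ?B"
        using card_inj_ext_ge[OF VH(1) sf(9), of "{1..n}" a] aV sf(9) n
        by (auto intro: inj_on_subset)
      moreover have "card (VH - V) = vH - card V" using card_Diff_subset[OF sf(1,9)] .
      ultimately show ?thesis using p by (intro mult_right_mono) auto
    qed
    also have "\<dots> = (\<Sum>b\<in>?B. p ^ (card EE + (card EE - card F)))" by simp
    also have "\<dots> \<le> (\<Sum>b\<in>?B. p ^ card (edge_image EE a \<union> edge_image EE b))"
      using le p by (intro sum_mono power_decreasing) auto
    also have "\<dots> \<le> (\<Sum>b\<in>nb a. p ^ card (edge_image EE a \<union> edge_image EE b))"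
      using B p finite_nb by (intro sum_mono2) auto
    finally show ?thesis .
  qed
  have "M\<^sup>2 / (?\<Phi> * vH ^ vH * 2 ^ vH) = M * (M / (?\<Phi> * vH ^ vH * 2 ^ vH))" by (simp add: power2_eq_square)
  also have "\<dots> \<le> M * r" using Mr M_pos by (intro mult_left_mono) auto
  also have "\<dots> = (\<Sum>a\<in>?A. p ^ card EE * r)" by (simp add: M_eq)
  also have "\<dots> \<le> (\<Sum>a\<in>?A. \<Sum>b\<in>nb a. p ^ card (edge_image EE a \<union> edge_image EE b))"
    by (intro sum_mono inner)
  finally show ?thesis .
qed

end
end
end

subsection \<open>Deviations of extension counts\<close>

lemma finite_tuples: "finite (tuples n vG)"
  unfolding tuples_def by (rule finite_Collect_conjI) (simp add: finite_PiE)

lemma card_tuples_le: "card (tuples n vG) \<le> n ^ vG"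
proof -
  have "card (tuples n vG) \<le> card ({1..vG} \<rightarrow>\<^sub>E {1..n})"
    unfolding tuples_def by (intro card_mono) (auto simp: finite_PiE)
  then show ?thesis by (simp add: card_PiE)
qed

lemma conc_prob_le:
  assumes "x \<in> tuples n vG"
  shows "conc_prob vG VH EH n p t \<le> measure_pmf.prob (Gnp n p)
    {E. \<bar>real (ext_count vG VH EH n x E) - mu vG VH EH n p\<bar> < t * mu vG VH EH n p}"
  unfolding conc_prob_def
proof (intro measure_pmf.finite_measure_mono subsetI CollectI)
  fix E assume "E \<in> {E. Max ((\<lambda>x. \<bar>real (ext_count vG VH EH n x E) - mu vG VH EH n p\<bar>) ` tuples n vG)
    < t * mu vG VH EH n p}"
  then show "\<bar>real (ext_count vG VH EH n x E) - mu vG VH EH n p\<bar> < t * mu vG VH EH n p"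
    using Max_ge[OF finite_imageI[OF finite_tuples] imageI[OF assms]]
    by (metis (no_types, lifting) le_less_trans mem_Collect_eq)
qed simp

text \<open>Union bound over the at most \<open>n ^ vG\<close> tuples. The bound \<open>B\<close> is
  nonnegative because some tuple exists, so the number of tuples may be replaced by its upper
  bound.\<close>

lemma conc_prob_ge:
  assumes "tuples n vG \<noteq> {}"
    and B: "\<And>x. x \<in> tuples n vG \<Longrightarrow> measure_pmf.prob (Gnp n p)
      {E. t * mu vG VH EH n p \<le> \<bar>real (ext_count vG VH EH n x E) - mu vG VH EH n p\<bar>} \<le> B"
  shows "1 - real n ^ vG * B \<le> conc_prob vG VH EH n p t"
proof -
  let ?d = "\<lambda>x E. \<bar>real (ext_count vG VH EH n x E) - mu vG VH EH n p\<bar>"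
  let ?good = "{E. Max ((\<lambda>x. ?d x E) ` tuples n vG) < t * mu vG VH EH n p}"
  obtain x0 where x0: "x0 \<in> tuples n vG" using assms(1) by blast
  have B0: "0 \<le> B" by (rule order_trans[OF measure_nonneg B[OF x0]])
  have "1 - conc_prob vG VH EH n p t = measure_pmf.prob (Gnp n p) (- ?good)"
    unfolding conc_prob_def using measure_pmf.prob_compl[of ?good "Gnp n p"] by (simp add: Compl_eq_Diff_UNIV)
  also have "\<dots> \<le> measure_pmf.prob (Gnp n p) (\<Union>x\<in>tuples n vG. {E. t * mu vG VH EH n p \<le> ?d x E})"
    by (intro measure_pmf.finite_measure_mono)
       (use assms(1) finite_tuples in \<open>auto simp: Max_less_iff not_less\<close>)
  also have "\<dots> \<le> (\<Sum>x\<in>tuples n vG. measure_pmf.prob (Gnp n p) {E. t * mu vG VH EH n p \<le> ?d x E})"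
    by (intro measure_pmf.finite_measure_subadditive_finite finite_tuples) auto
  also have "\<dots> \<le> (\<Sum>x\<in>tuples n vG. B)" by (intro sum_mono B)
  also have "\<dots> \<le> real n ^ vG * B"
    using card_tuples_le[of n vG] B0 by (auto intro!: mult_right_mono simp flip: of_nat_power)
  finally show ?thesis by simp
qed

section \<open>Deviation probabilities at a fixed n\<close>

context rooted
begin

lemma overlap_const_pos: "0 < overlap_const m"
  unfolding overlap_const_def by (intro mult_pos_pos zero_less_power add_nonneg_pos) auto

context
  fixes n :: nat and p :: real and x
  assumes p: "0 \<le> p" "p \<le> 1" and n: "2 * vH \<le> n"
    and x: "x \<in> tuples n vG" and Phi_pos: "0 < Phi vG VH EH n p"
begin

interpretation copies "all_edges {1..n}" p "emb vG VH n x" "edge_image EE"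
  by (rule copies_emb[OF VH(1) EE_subset p])

lemma K_pos: "0 < real (card (root_auts vG VH EH))"
  using card_root_auts(1)[OF VH] by simp

lemma K_mu_eq: "card (root_auts vG VH EH) * mu vG VH EH n p = M"
  using mu_eq[OF VH p, of n] card_emb_eq[OF VH(1,2) _ x] vG_le n M_eq[OF p n x Phi_pos] by simp

lemma K_dev_eq: "card (root_auts vG VH EH) *
    \<bar>real (ext_count vG VH EH n x {e \<in> all_edges {1..n}. f e}) - mu vG VH EH n p\<bar> = \<bar>W f\<bar>"
proof -
  let ?K = "real (card (root_auts vG VH EH))"
  have "?K * \<bar>real (ext_count vG VH EH n x {e \<in> all_edges {1..n}. f e}) - mu vG VH EH n p\<bar>
     = \<bar>?K * real (ext_count vG VH EH n x {e \<in> all_edges {1..n}. f e}) - ?K * mu vG VH EH n p\<bar>"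
    by (simp add: abs_mult flip: right_diff_distrib)
  also have "\<dots> = \<bar>W f\<bar>"
    unfolding K_mu_eq ext_count_eq_W[OF VH p] M_eq[OF p n x Phi_pos] by simp
  finally show ?thesis .
qed

text \<open>The number of symmetries multiplies both the deviation and the mean, and so cancels from
  relative deviations.\<close>

lemma dev_less_iff:
  "\<bar>real (ext_count vG VH EH n x {e \<in> all_edges {1..n}. f e}) - mu vG VH EH n p\<bar> < t * mu vG VH EH n p
    \<longleftrightarrow> \<bar>W f\<bar> < t * M"
proof -
  let ?K = "real (card (root_auts vG VH EH))"
  have "\<bar>W f\<bar> < t * M \<longleftrightarrow>
    ?K * \<bar>real (ext_count vG VH EH n x {e \<in> all_edges {1..n}. f e}) - mu vG VH EH n p\<bar> < ?K * (t * mu vG VH EH n p)"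
    unfolding K_dev_eq by (simp add: K_mu_eq[symmetric] mult_ac)
  then show ?thesis using K_pos by (simp only: mult_less_cancel_left_pos)
qed

text \<open>The Stein bound with \<open>\<theta>\<close> equal to \<open>overlap_const 4\<close>
  divided by \<open>Phi\<close>. The constant \<open>c\<close> is the variance bound from
  \<open>variance_ge\<close> and \<open>overlap_lower\<close>, rewritten in terms of this
  \<open>\<theta>\<close>.\<close>

lemma prob_dev_less_le:
  assumes \<eta>: "0 < \<eta>" and c0: "0 < c0" "c0 \<le> 1 - p"
    and small: "overlap_const 4 / Phi vG VH EH n p \<le> 1"
    and t: "t \<le> \<eta> * sqrt (overlap_const 4 / Phi vG VH EH n p)"
  defines "c \<equiv> c0 / (vH ^ vH * 2 ^ vH * overlap_const 4)"
    and "s \<equiv> sqrt (overlap_const 4 / Phi vG VH EH n p)"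
  shows "measure_pmf.prob (Gnp n p)
      {E. \<bar>real (ext_count vG VH EH n x E) - mu vG VH EH n p\<bar> < t * mu vG VH EH n p}
    \<le> 4 * \<eta> / sqrt c + 64 * s / c + 128 * s / (c * \<eta>)"
proof -
  let ?\<theta> = "overlap_const 4 / Phi vG VH EH n p"
  have M0: "0 < M" by (rule M_pos[OF p n x Phi_pos])
  have C: "0 < real vH ^ vH * 2 ^ vH * overlap_const 4" using vH_pos overlap_const_pos by simp
  have c: "0 < c" unfolding c_def using c0 C by (intro divide_pos_pos) auto
  have "c * ?\<theta> = c0 / (Phi vG VH EH n p * vH ^ vH * 2 ^ vH)"
    unfolding c_def using overlap_const_pos[of 4] by (simp add: mult_ac)
  moreover have "c * M\<^sup>2 * ?\<theta> = M\<^sup>2 * (c * ?\<theta>)" by (simp only: mult_ac)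
  ultimately have "c * M\<^sup>2 * ?\<theta> = c0 * (M\<^sup>2 / (Phi vG VH EH n p * vH ^ vH * 2 ^ vH))"
    by (simp only: times_divide_eq_right mult.commute)
  also have "\<dots> \<le> (1 - p) * (M\<^sup>2 / (Phi vG VH EH n p * vH ^ vH * 2 ^ vH))"
    using c0 Phi_pos by (intro mult_right_mono) auto
  also have "\<dots> \<le> (1 - p) * (\<Sum>a\<in>emb vG VH n x. \<Sum>b\<in>nb a. p ^ card (edge_image EE a \<union> edge_image EE b))"
    using overlap_lower[OF p n x Phi_pos] p by (intro mult_left_mono) auto
  also have "\<dots> \<le> expec (\<lambda>f. (W f)\<^sup>2)" by (rule variance_ge)
  finally have var: "c * M\<^sup>2 * ?\<theta> \<le> expec (\<lambda>f. (W f)\<^sup>2)" .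
  have "measure_pmf.prob (Gnp n p)
      {E. \<bar>real (ext_count vG VH EH n x E) - mu vG VH EH n p\<bar> < t * mu vG VH EH n p}
    = measure_pmf.prob Om {f. \<bar>W f\<bar> < t * M}"
    by (simp only: Gnp_def measure_map_pmf vimage_def mem_Collect_eq dev_less_iff)
  also have "\<dots> \<le> measure_pmf.prob Om {f. \<bar>W f\<bar> \<le> \<eta> * M * s}"
  proof (intro measure_pmf.finite_measure_mono subsetI)
    fix f assume "f \<in> {f. \<bar>W f\<bar> < t * M}"
    moreover have "t * M \<le> \<eta> * M * s" using mult_right_mono[OF t, of M] M0 by (simp add: s_def mult_ac)
    ultimately show "f \<in> {f. \<bar>W f\<bar> \<le> \<eta> * M * s}" by simp
  qed simp
  also have "\<dots> \<le> 4 * \<eta> / sqrt c + 64 * s / c + 128 * s / (c * \<eta>)"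
    unfolding s_def
    by (rule prob_abs_W_le[OF divide_pos_pos[OF overlap_const_pos Phi_pos] small M0 \<eta> c var
          overlap_upper[OF p n x Phi_pos]])
  finally show ?thesis .
qed

text \<open>Markov's inequality for the moment of order \<open>2 * k\<close>; the powers of
  \<open>M\<close> cancel.\<close>

lemma prob_dev_ge_le:
  assumes t: "0 < t" and small: "overlap_const (2 * k) / Phi vG VH EH n p \<le> 1"
  shows "measure_pmf.prob (Gnp n p)
      {E. t * mu vG VH EH n p \<le> \<bar>real (ext_count vG VH EH n x E) - mu vG VH EH n p\<bar>}
    \<le> 2 * 4 ^ (2 * k) * (overlap_const (2 * k) / (t\<^sup>2 * Phi vG VH EH n p)) ^ k"
proof -
  let ?\<theta> = "overlap_const (2 * k) / Phi vG VH EH n p"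
  have M0: "0 < M" by (rule M_pos[OF p n x Phi_pos])
  have "measure_pmf.prob (Gnp n p)
      {E. t * mu vG VH EH n p \<le> \<bar>real (ext_count vG VH EH n x E) - mu vG VH EH n p\<bar>}
    = measure_pmf.prob Om {f. t * M \<le> \<bar>W f\<bar>}"
    by (simp only: Gnp_def measure_map_pmf vimage_def mem_Collect_eq dev_less_iff flip: not_less)
  also have "\<dots> \<le> expec (\<lambda>f. W f ^ (2 * k)) / (t * M) ^ (2 * k)"
    using t M0 by (intro prob_abs_W_ge) simp
  also have "\<dots> \<le> (2 * 4 ^ (2 * k) * M ^ (2 * k) * ?\<theta> ^ k) / (t * M) ^ (2 * k)"
    by (intro divide_right_mono expec_W_even_power_le overlap_upper[OF p n x Phi_pos] small
         divide_pos_pos[OF overlap_const_pos Phi_pos]) (use t M0 in auto)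
  also have "\<dots> = 2 * 4 ^ (2 * k) * (?\<theta> ^ k / (t\<^sup>2) ^ k)"
    using M0 t by (simp add: power_mult_distrib power_mult)
  also have "?\<theta> ^ k / (t\<^sup>2) ^ k = (overlap_const (2 * k) / (t\<^sup>2 * Phi vG VH EH n p)) ^ k"
    by (simp add: mult.commute flip: power_divide)
  finally show ?thesis .
qed

end

section \<open>Limits as n tends to infinity\<close>

context
  fixes p \<epsilon> :: "nat \<Rightarrow> real"
  assumes p: "\<And>n. 0 \<le> p n" "\<And>n. p n \<le> 1" and \<epsilon>: "\<And>n. 0 < \<epsilon> n"
    and lim: "filterlim (\<lambda>n. Phi vG VH EH n (p n)) at_top sequentially"
begin

lemma theta_tendsto_0: "(\<lambda>n. overlap_const m / Phi vG VH EH n (p n)) \<longlonglongrightarrow> 0"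
  by (intro real_tendsto_divide_at_top[OF tendsto_const lim])

lemma eventually_basic:
  "eventually (\<lambda>n. 2 * vH \<le> n \<and> 0 < Phi vG VH EH n (p n) \<and> overlap_const m / Phi vG VH EH n (p n) \<le> 1) sequentially"
proof (intro eventually_conj)
  show "eventually (\<lambda>n. 2 * vH \<le> n) sequentially" by (rule eventually_ge_at_top)
  show "eventually (\<lambda>n. 0 < Phi vG VH EH n (p n)) sequentially"
    using lim by (simp add: filterlim_at_top_dense)
  show "eventually (\<lambda>n. overlap_const m / Phi vG VH EH n (p n) \<le> 1) sequentially"
    using order_tendstoD(2)[OF theta_tendsto_0[of m], of 1] by (auto elim: eventually_mono)
qed

lemma conc_prob_tendsto_0:
  assumes c0: "0 < c0" "eventually (\<lambda>n. c0 \<le> 1 - p n) sequentially"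
    and small: "(\<lambda>n. (\<epsilon> n)\<^sup>2 * Phi vG VH EH n (p n)) \<longlonglongrightarrow> 0"
  shows "(\<lambda>n. conc_prob vG VH EH n (p n) (\<epsilon> n)) \<longlonglongrightarrow> 0"
proof (rule order_tendstoI)
  fix a :: real assume "a < 0"
  then show "eventually (\<lambda>n. a < conc_prob vG VH EH n (p n) (\<epsilon> n)) sequentially"
    by (intro always_eventually allI) (auto simp: conc_prob_def intro: less_le_trans)
next
  fix a :: real assume a: "0 < a"
  define c where "c = c0 / (vH ^ vH * 2 ^ vH * overlap_const 4)"
  have C: "0 < real vH ^ vH * 2 ^ vH * overlap_const 4" using vH_pos overlap_const_pos by simp
  have c: "0 < c" unfolding c_def using c0 C by (intro divide_pos_pos) auto
  \<comment> \<open>Chosen so that the first term of \<open>prob_dev_less_le\<close> equals a/4; the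
    other two together are eventually below a/4.\<close>
  define \<eta> where "\<eta> = a * sqrt c / 16"
  have \<eta>: "0 < \<eta>" using a c by (simp add: \<eta>_def)
  have \<eta>a: "4 * \<eta> / sqrt c = a / 4" using c by (simp add: \<eta>_def)
  define s where "s n = sqrt (overlap_const 4 / Phi vG VH EH n (p n))" for n
  have s: "s \<longlonglongrightarrow> 0" unfolding s_def using tendsto_real_sqrt[OF theta_tendsto_0[of 4]] by simp
  have "(\<lambda>n. 64 * s n / c + 128 * s n / (c * \<eta>)) \<longlonglongrightarrow> 64 * 0 / c + 128 * 0 / (c * \<eta>)"
    using c \<eta> by (intro tendsto_intros s) auto
  then have ev1: "eventually (\<lambda>n. 64 * s n / c + 128 * s n / (c * \<eta>) < a / 4) sequentially"
    using a by (intro order_tendstoD(2)) auto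
  \<comment> \<open>After division by \<open>Phi\<close> and taking roots this says that
    \<open>\<epsilon> n\<close> is at most \<open>\<eta> * s n\<close>, the deviation covered by
    \<open>prob_dev_less_le\<close>.\<close>
  have ev2: "eventually (\<lambda>n. (\<epsilon> n)\<^sup>2 * Phi vG VH EH n (p n) < \<eta>\<^sup>2 * overlap_const 4) sequentially"
    using \<eta> overlap_const_pos[of 4] by (intro order_tendstoD(2)[OF small]) auto
  show "eventually (\<lambda>n. conc_prob vG VH EH n (p n) (\<epsilon> n) < a) sequentially"
    using ev1 ev2 c0(2) eventually_basic[of 4]
  proof eventually_elim
    case (elim n)
    let ?\<Phi> = "Phi vG VH EH n (p n)"
    have n: "2 * vH \<le> n" and \<Phi>: "0 < ?\<Phi>" and th: "overlap_const 4 / ?\<Phi> \<le> 1" using elim by auto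
    let ?x = "restrict (\<lambda>j. j) {1..vG}"
    have x: "?x \<in> tuples n vG" using n vG_le by (intro id_tuple) simp
    have "(\<epsilon> n)\<^sup>2 \<le> \<eta>\<^sup>2 * (overlap_const 4 / ?\<Phi>)"
      using elim \<Phi> by (simp add: pos_le_divide_eq)
    also have "\<dots> = (\<eta> * s n)\<^sup>2"
      using \<Phi> overlap_const_pos[of 4] by (simp add: s_def power_mult_distrib)
    finally have "\<epsilon> n \<le> \<eta> * s n"
      by (rule power2_le_imp_le) (use \<eta> \<Phi> overlap_const_pos[of 4] in \<open>simp add: s_def\<close>)
    from prob_dev_less_le[OF p(1) p(2) n x \<Phi> \<eta> c0(1) _ th this[unfolded s_def]]
    have "measure_pmf.prob (Gnp n (p n))
      {E. \<bar>real (ext_count vG VH EH n ?x E) - mu vG VH EH n (p n)\<bar> < \<epsilon> n * mu vG VH EH n (p n)}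
      \<le> a / 4 + 64 * s n / c + 128 * s n / (c * \<eta>)"
      using elim unfolding c_def[symmetric] s_def[symmetric] \<eta>a by simp
    also have "\<dots> < a" using elim a by linarith
    finally show ?case by (rule le_less_trans[OF conc_prob_le[OF x]])
  qed
qed

lemma conc_prob_tendsto_1:
  assumes c: "0 < c" "eventually (\<lambda>n. real n powr c \<le> (\<epsilon> n)\<^sup>2 * Phi vG VH EH n (p n)) sequentially"
  shows "(\<lambda>n. conc_prob vG VH EH n (p n) (\<epsilon> n)) \<longlonglongrightarrow> 1"
proof -
  \<comment> \<open>Large enough that the k-th power of \<open>n powr c\<close> is at least
    \<open>n ^ (vG + 1)\<close>, so the union bound over at most \<open>n ^ vG\<close> tuples leaves
    a failure probability of order 1/n.\<close>
  define k where "k = nat \<lceil>(real vG + 1) / c\<rceil>"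
  have "(real vG + 1) / c \<le> real k" unfolding k_def by linarith
  then have k: "real vG + 1 \<le> c * real k" using c(1) by (simp add: pos_divide_le_eq mult.commute)
  define C where "C = 2 * 4 ^ (2 * k) * overlap_const (2 * k) ^ k"
  have C0: "0 \<le> C" unfolding C_def using overlap_const_pos[of "2 * k"] by simp
  have "eventually (\<lambda>n. 1 - C / real n \<le> conc_prob vG VH EH n (p n) (\<epsilon> n)) sequentially"
    using c(2) eventually_basic[of "2 * k"] eventually_gt_at_top[of 0]
  proof eventually_elim
    case (elim n)
    let ?\<Phi> = "Phi vG VH EH n (p n)"
    have n: "2 * vH \<le> n" and \<Phi>: "0 < ?\<Phi>" and th: "overlap_const (2 * k) / ?\<Phi> \<le> 1" and n0: "0 < n"
      using elim by auto
    have ne: "tuples n vG \<noteq> {}" using id_tuple[of vG n] n vG_le by auto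
    have "real n ^ vG * (2 * 4 ^ (2 * k) * (overlap_const (2 * k) / ((\<epsilon> n)\<^sup>2 * ?\<Phi>)) ^ k)
        = real n ^ vG * (C / ((\<epsilon> n)\<^sup>2 * ?\<Phi>) ^ k)"
      by (simp add: C_def power_divide)
    also have "\<dots> \<le> real n ^ vG * (C / real n ^ (vG + 1))"
    proof (intro mult_left_mono divide_left_mono)
      have "real n ^ (vG + 1) = real n powr (real vG + 1)"
        using n0 powr_realpow[of "real n" "vG + 1"] by (simp add: add.commute)
      also have "\<dots> \<le> real n powr (c * real k)" using k n0 by (intro powr_mono) auto
      also have "\<dots> = (real n powr c) ^ k" using n0 by (simp add: powr_powr[symmetric] powr_realpow)
      also have "\<dots> \<le> ((\<epsilon> n)\<^sup>2 * ?\<Phi>) ^ k" using elim by (intro power_mono) auto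
      finally show "real n ^ (vG + 1) \<le> ((\<epsilon> n)\<^sup>2 * ?\<Phi>) ^ k" .
      show "0 < ((\<epsilon> n)\<^sup>2 * ?\<Phi>) ^ k * real n ^ (vG + 1)" using \<Phi> \<epsilon>[of n] n0 by simp
    qed (use C0 in auto)
    also have "\<dots> = C / real n" using n0 by simp
    finally have "real n ^ vG * (2 * 4 ^ (2 * k) * (overlap_const (2 * k) / ((\<epsilon> n)\<^sup>2 * ?\<Phi>)) ^ k) \<le> C / real n" .
    moreover have "1 - real n ^ vG * (2 * 4 ^ (2 * k) * (overlap_const (2 * k) / ((\<epsilon> n)\<^sup>2 * ?\<Phi>)) ^ k)
       \<le> conc_prob vG VH EH n (p n) (\<epsilon> n)"
      by (intro conc_prob_ge[OF ne] prob_dev_ge_le p n \<Phi> \<epsilon> th)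
    ultimately show ?case by linarith
  qed
  moreover have "eventually (\<lambda>n. conc_prob vG VH EH n (p n) (\<epsilon> n) \<le> 1) sequentially"
    by (simp add: conc_prob_def)
  moreover have "(\<lambda>n. 1 - C / real n) \<longlonglongrightarrow> 1"
    using tendsto_diff[OF tendsto_const lim_const_over_n[of C], of 1] by simp
  ultimately show ?thesis using tendsto_const by (rule real_tendsto_sandwich)
qed

end
end

theorem theorem4:
  fixes vG :: nat and VH :: "nat set" and EH :: "nat set set"
    and p \<epsilon> :: "nat \<Rightarrow> real"
  assumes "rooted_graph vG VH EH"
    and "\<forall>n. 0 \<le> p n \<and> p n \<le> 1"
    and "\<forall>n. 0 < \<epsilon> n \<and> \<epsilon> n \<le> 1"
    and "\<exists>c>0. eventually (\<lambda>n. 1 - p n \<ge> c) sequentially"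
    and "filterlim (\<lambda>n. Phi vG VH EH n (p n)) at_top sequentially"
  shows "((\<lambda>n. (\<epsilon> n)\<^sup>2 * Phi vG VH EH n (p n)) \<longlonglongrightarrow> 0
            \<longrightarrow> (\<lambda>n. conc_prob vG VH EH n (p n) (\<epsilon> n)) \<longlonglongrightarrow> 0)
       \<and> ((\<exists>c>0. eventually (\<lambda>n. (\<epsilon> n)\<^sup>2 * Phi vG VH EH n (p n) \<ge> real n powr c) sequentially)
            \<longrightarrow> (\<lambda>n. conc_prob vG VH EH n (p n) (\<epsilon> n)) \<longlonglongrightarrow> 1)"
proof -
  interpret rooted vG VH EH by unfold_locales (rule assms(1))
  have p: "\<And>n. 0 \<le> p n" "\<And>n. p n \<le> 1" and \<epsilon>: "\<And>n. 0 < \<epsilon> n" using assms(2,3) by auto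
  show ?thesis
  proof (intro conjI impI)
    assume "(\<lambda>n. (\<epsilon> n)\<^sup>2 * Phi vG VH EH n (p n)) \<longlonglongrightarrow> 0"
    moreover obtain c where "0 < c" "eventually (\<lambda>n. c \<le> 1 - p n) sequentially" using assms(4) by blast
    ultimately show "(\<lambda>n. conc_prob vG VH EH n (p n) (\<epsilon> n)) \<longlonglongrightarrow> 0"
      by (intro conc_prob_tendsto_0[OF p \<epsilon> assms(5)])
  next
    assume "\<exists>c>0. eventually (\<lambda>n. (\<epsilon> n)\<^sup>2 * Phi vG VH EH n (p n) \<ge> real n powr c) sequentially"
    then obtain c where "0 < c" "eventually (\<lambda>n. real n powr c \<le> (\<epsilon> n)\<^sup>2 * Phi vG VH EH n (p n)) sequentially"
      by blast
    then show "(\<lambda>n. conc_prob vG VH EH n (p n) (\<epsilon> n)) \<longlonglongrightarrow> 1"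
      by (rule conc_prob_tendsto_1[OF p \<epsilon> assms(5)])
  qed
qed

end
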